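(* Let $G=(V,E)$ be a graph with edge coloring $\mathcal{C}:E\to C$ and let $S\subseteq V$ be a set of terminals. Suppose that $G$ has no alternating trail connecting distinct terminals. Let $(I,\pi,F)$ be a maximal colored blossom forest (with respect to the partial order $<$ on colored blossom forests). Let $A$ be the set of inner vertices of $G$ with respect to $(I,\pi,F)$, and for each $c\in C$ define \[A(c)=\{u\in A:\text{the predecessor edge of }[u]\text{ in }F\text{ has color }c\}.\] Then $A$ is a Tutte set with coloring given by $A=\dot\bigcup_{c\in C}A(c)$.
   Context: Graphs are finite and undirected; parallel edges are allowed, loops are not. Colors come from a set $C$ with $\#C\ge 2$. A $v_0$-$v_m$ walk is a sequence $W=(v_0,e_1,v_1,\ldots,e_m,v_m)$, $m\ge 0$, where each $e_j\in E$ has endpoints $v_{j-1},v_j$. Its length is $m$, its first edge is $e_1$ and its last edge is $e_m$. It is a trail when its edges are distinct; closed when $v_0=v_m$; internally alternating when $\mathcal{C}(e_j)\ne\mathcal{C}(e_{j+1})$ for $j=1,\ldots,m-1$; alternating when in addition, if $W$ is closed, $\mathcal{C}(e_m)\ne\mathcal{C}(e_1)$. A trail connects distinct terminals if it is an $s$-$t$ trail with $s,t\in S$, $s\ne t$. Tutte set: $A\subseteq V-S$ is a Tutte set with coloring $A=\dot\bigcup_{c\in C}A(c)$ (disjoint union, empty blocks allowed; $u\in A(c)$ is said to have color $c$) when (i) each component of $G-A$ contains at most one terminal; and (ii): (a) if a component $H$ of $G-A$ contains a terminal, no mismatched edge has an endpoint in $H$; (b) if a component $H$ of $G-A$ contains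 no terminal, at most one mismatched edge has an endpoint in $H$; (c) no mismatched edge has both endpoints in $A$. Here an edge $e$ is mismatched if either it connects $u\in A$ with $v\in V-A$ and $\mathcal{C}(e)$ differs from the color of $u$, or it connects $u,v\in A$ and $\mathcal{C}(e)$ differs from both the colors of $u$ and of $v$. Blossoms: a subgraph $G'=(V',E')$ of $G$ is a blossom with base $u$ when $u\in V'$ and for each $v\in V'$, $v\ne u$, $G'$ has two alternating $v$-$u$ trails whose first edges have different colors. For $c\in C$, $G'$ is a $c$-blossom with base $u$ when (i) $u\in V'$; (ii) for each $v\in V'$, $v\neq u$, $G'$ has two alternating $v$-$u$ trails whose first edges have different colors and whose last edges have colors different from $c$; (iii) $G'$ has an internally alternating $u$-$u$ trail of positive length whose first and last edges have colors different from $c$. For a partition $\pi$ of the vertex set of a graph $K$, $K\times\pi$ is the graph whose vertices are the blocks of $\pi$ and whose edges are the edges of $K$ joining different blocks (with those blocks as endpoints). $[v]$ is the block of $\pi$ containing $v$; $G[U]$ is the subgraph induced on $U$. In a rooted forest, the predecessor edge of a non-root vertex $x$ is the first edge of the unique path from $x$ to the root of its component. A colored blossom forest is a triple $(I,\pi,F)$ with $S\subseteq I\subseteq V$, $\pi$ a partition of $I$, and $F$ a rooted forest in $G[I]\times\pi$ (whose vertices are all the blocks of $\pi$) such that: (i) $F$ has $\#S$ components and its roots are $[s]$, $s\in S$; (ii) for each $s\in S$, $G[[s]]$ is a blossom with base $s$; (iii) if $[v]$ is a non-root vertex of $F$ with $\#[v]=1$, with predecessor edge $e$, then all edges of $F$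 between $[v]$ and its children have colors different from $\mathcal{C}(e)$; (iv) if $[v]$ is a non-root vertex of $F$ with $\#[v]\ge2$, its predecessor edge has color $c$, and $u\in[v]$ is the endpoint (in $G$) of that edge contained in $[v]$, then $G[[v]]$ is a $c$-blossom with base $u$. A vertex $v\in I$ is an inner vertex if $\#[v]=1$ and $[v]$ is a non-root vertex of $F$. Partial order: $(I,\pi,F)<(I',\pi',F')$ if $I\subsetneq I'$, or $I=I'$ and $\pi<\pi'$ (every block of $\pi$ is contained in a block of $\pi'$ and $\pi\ne\pi'$). *)

theory Defs
  imports "HOL-Library.Disjoint_Sets"
begin

section \<open>Undirected multigraphs\<close>

text \<open>Edges are abstract, so that parallel edges are distinct; \<open>ends G e\<close> is the set
  of endpoints of \<open>e\<close> and is only meaningful for \<open>e \<in> edges G\<close>.\<close>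

record ('v, 'e) mgraph =
  verts :: "'v set"
  edges :: "'e set"
  ends :: "'e \<Rightarrow> 'v set"

definition multigraph :: "('v, 'e, 'x) mgraph_scheme \<Rightarrow> bool" where
  "multigraph G \<longleftrightarrow> finite (verts G) \<and> finite (edges G) \<and>
     (\<forall>e\<in>edges G. ends G e \<subseteq> verts G \<and> card (ends G e) = 2)"

definition is_subgraph :: "('v, 'e, 'x) mgraph_scheme \<Rightarrow> ('v, 'e, 'y) mgraph_scheme \<Rightarrow> bool" where
  "is_subgraph H G \<longleftrightarrow> verts H \<subseteq> verts G \<and> edges H \<subseteq> edges G \<and>
     (\<forall>e\<in>edges H. ends H e = ends G e \<and> ends H e \<subseteq> verts H)"

definition induced :: "('v, 'e, 'x) mgraph_scheme \<Rightarrow> 'v set \<Rightarrow> ('v, 'e) mgraph" where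
  "induced G U =
     \<lparr>verts = verts G \<inter> U, edges = {e \<in> edges G. ends G e \<subseteq> U}, ends = ends G\<rparr>"

text \<open>The walk \<open>(v\<^sub>0, e\<^sub>1, v\<^sub>1, \<dots>, e\<^sub>m, v\<^sub>m)\<close> is given by the vertex list \<open>vs = [v\<^sub>0, \<dots>, v\<^sub>m]\<close>
  and the edge list \<open>es = [e\<^sub>1, \<dots>, e\<^sub>m]\<close>.\<close>

definition is_walk ::
  "('v, 'e, 'x) mgraph_scheme \<Rightarrow> 'v \<Rightarrow> 'v list \<Rightarrow> 'e list \<Rightarrow> 'v \<Rightarrow> bool" where
  "is_walk G u vs es v \<longleftrightarrow>
     length vs = Suc (length es) \<and> hd vs = u \<and> last vs = v \<and>
     set vs \<subseteq> verts G \<and> set es \<subseteq> edges G \<and>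
     (\<forall>j<length es. ends G (es ! j) = {vs ! j, vs ! Suc j})"

definition is_trail ::
  "('v, 'e, 'x) mgraph_scheme \<Rightarrow> 'v \<Rightarrow> 'v list \<Rightarrow> 'e list \<Rightarrow> 'v \<Rightarrow> bool" where
  "is_trail G u vs es v \<longleftrightarrow> is_walk G u vs es v \<and> distinct es"

definition is_path ::
  "('v, 'e, 'x) mgraph_scheme \<Rightarrow> 'v \<Rightarrow> 'v list \<Rightarrow> 'e list \<Rightarrow> 'v \<Rightarrow> bool" where
  "is_path G u vs es v \<longleftrightarrow> is_walk G u vs es v \<and> distinct vs"

definition component_of :: "('v, 'e, 'x) mgraph_scheme \<Rightarrow> 'v \<Rightarrow> 'v set" where
  "component_of G v = {w. \<exists>vs es. is_walk G v vs es w}"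

text \<open>Components are represented by their vertex sets.\<close>

definition graph_components :: "('v, 'e, 'x) mgraph_scheme \<Rightarrow> 'v set set" where
  "graph_components G = component_of G ` verts G"

section \<open>Alternating trails\<close>

definition int_alternating :: "('e \<Rightarrow> 'c) \<Rightarrow> 'e list \<Rightarrow> bool" where
  "int_alternating col es \<longleftrightarrow> (\<forall>j. Suc j < length es \<longrightarrow> col (es ! j) \<noteq> col (es ! Suc j))"

definition int_alternating_trail ::
  "('v, 'e, 'x) mgraph_scheme \<Rightarrow> ('e \<Rightarrow> 'c) \<Rightarrow> 'v \<Rightarrow> 'v list \<Rightarrow> 'e list \<Rightarrow> 'v \<Rightarrow> bool" where
  "int_alternating_trail G col u vs es v \<longleftrightarrow> is_trail G u vs es v \<and> int_alternating col es"

text \<open>The closing condition is vacuous for the trail of length 0, which has no edges.\<close>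

definition alternating_trail ::
  "('v, 'e, 'x) mgraph_scheme \<Rightarrow> ('e \<Rightarrow> 'c) \<Rightarrow> 'v \<Rightarrow> 'v list \<Rightarrow> 'e list \<Rightarrow> 'v \<Rightarrow> bool" where
  "alternating_trail G col u vs es v \<longleftrightarrow> int_alternating_trail G col u vs es v \<and>
     (u = v \<and> es \<noteq> [] \<longrightarrow> col (last es) \<noteq> col (hd es))"

definition connects_distinct_terminals ::
  "('v, 'e, 'x) mgraph_scheme \<Rightarrow> 'v set \<Rightarrow> 'v list \<Rightarrow> 'e list \<Rightarrow> bool" where
  "connects_distinct_terminals G S vs es \<longleftrightarrow>
     (\<exists>s\<in>S. \<exists>t\<in>S. s \<noteq> t \<and> is_trail G s vs es t)"

section \<open>Tutte sets\<close>

text \<open>A coloring of \<open>A\<close> is a family \<open>Ac\<close> of blocks indexed by the color set \<open>Cols\<close>;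
  \<open>u\<close> has color \<open>c\<close> if \<open>c \<in> Cols\<close> and \<open>u \<in> Ac c\<close>.\<close>

definition mismatched ::
  "('v, 'e, 'x) mgraph_scheme \<Rightarrow> ('e \<Rightarrow> 'c) \<Rightarrow> 'c set \<Rightarrow> 'v set \<Rightarrow> ('c \<Rightarrow> 'v set) \<Rightarrow> 'e \<Rightarrow> bool" where
  "mismatched G col Cols A Ac e \<longleftrightarrow> e \<in> edges G \<and>
     ((\<exists>u\<in>A. \<exists>v\<in>verts G - A. ends G e = {u, v} \<and>
         (\<exists>c\<in>Cols. u \<in> Ac c \<and> col e \<noteq> c)) \<or>
      (\<exists>u\<in>A. \<exists>v\<in>A. ends G e = {u, v} \<and>
         (\<exists>c\<in>Cols. \<exists>d\<in>Cols. u \<in> Ac c \<and> v \<in> Ac d \<and> col e \<noteq> c \<and> col e \<noteq> d)))"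

definition tutte_set ::
  "('v, 'e, 'x) mgraph_scheme \<Rightarrow> ('e \<Rightarrow> 'c) \<Rightarrow> 'c set \<Rightarrow> 'v set \<Rightarrow> 'v set \<Rightarrow> ('c \<Rightarrow> 'v set) \<Rightarrow> bool" where
  "tutte_set G col Cols S A Ac \<longleftrightarrow>
     A \<subseteq> verts G - S \<and>
     A = (\<Union>c\<in>Cols. Ac c) \<and> disjoint_family_on Ac Cols \<and>
     (\<forall>H \<in> graph_components (induced G (verts G - A)). card (H \<inter> S) \<le> 1) \<and>
     (\<forall>H \<in> graph_components (induced G (verts G - A)). H \<inter> S \<noteq> {} \<longrightarrow>
        \<not> (\<exists>e. mismatched G col Cols A Ac e \<and> ends G e \<inter> H \<noteq> {})) \<and>
     (\<forall>H \<in> graph_components (induced G (verts G - A)). H \<inter> S = {} \<longrightarrow>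
        card {e. mismatched G col Cols A Ac e \<and> ends G e \<inter> H \<noteq> {}} \<le> 1) \<and>
     \<not> (\<exists>e. mismatched G col Cols A Ac e \<and> ends G e \<subseteq> A)"

section \<open>Blossoms\<close>

definition blossom :: "('v, 'e, 'x) mgraph_scheme \<Rightarrow> ('e \<Rightarrow> 'c) \<Rightarrow> 'v \<Rightarrow> bool" where
  "blossom G' col u \<longleftrightarrow> u \<in> verts G' \<and>
     (\<forall>v\<in>verts G'. v \<noteq> u \<longrightarrow>
        (\<exists>vs es ws fs. alternating_trail G' col v vs es u \<and> alternating_trail G' col v ws fs u \<and>
           col (hd es) \<noteq> col (hd fs)))"

definition c_blossom :: "('v, 'e, 'x) mgraph_scheme \<Rightarrow> ('e \<Rightarrow> 'c) \<Rightarrow> 'c \<Rightarrow> 'v \<Rightarrow> bool" where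
  "c_blossom G' col c u \<longleftrightarrow> u \<in> verts G' \<and>
     (\<forall>v\<in>verts G'. v \<noteq> u \<longrightarrow>
        (\<exists>vs es ws fs. alternating_trail G' col v vs es u \<and> alternating_trail G' col v ws fs u \<and>
           col (hd es) \<noteq> col (hd fs) \<and> col (last es) \<noteq> c \<and> col (last fs) \<noteq> c)) \<and>
     (\<exists>vs es. int_alternating_trail G' col u vs es u \<and> es \<noteq> [] \<and>
        col (hd es) \<noteq> c \<and> col (last es) \<noteq> c)"

section \<open>Contraction and rooted forests\<close>

text \<open>The contraction by \<open>\<pi>\<close> keeps the names of the edges of \<open>K\<close> joining different blocks.\<close>

definition contract :: "('v, 'e, 'x) mgraph_scheme \<Rightarrow> 'v set set \<Rightarrow> ('v set, 'e) mgraph" where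
  "contract K \<pi> =
     \<lparr>verts = \<pi>,
      edges = {e \<in> edges K. \<exists>B\<in>\<pi>. \<exists>B'\<in>\<pi>. B \<noteq> B' \<and> ends K e \<inter> B \<noteq> {} \<and> ends K e \<inter> B' \<noteq> {}},
      ends = (\<lambda>e. {B \<in> \<pi>. ends K e \<inter> B \<noteq> {}})\<rparr>"

definition block :: "'v set set \<Rightarrow> 'v \<Rightarrow> 'v set" where
  "block \<pi> v = (THE B. B \<in> \<pi> \<and> v \<in> B)"

text \<open>Two parallel edges form a cycle.\<close>

definition is_cycle :: "('v, 'e, 'x) mgraph_scheme \<Rightarrow> 'v list \<Rightarrow> 'e list \<Rightarrow> bool" where
  "is_cycle G vs es \<longleftrightarrow> es \<noteq> [] \<and> is_trail G (hd vs) vs es (hd vs) \<and> distinct (tl vs)"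

record ('v, 'e) rooted_graph = "('v, 'e) mgraph" +
  roots :: "'v set"

definition rooted_forest :: "('v, 'e) rooted_graph \<Rightarrow> bool" where
  "rooted_forest F \<longleftrightarrow> multigraph F \<and> \<not> (\<exists>vs es. is_cycle F vs es) \<and> roots F \<subseteq> verts F \<and>
     (\<forall>H\<in>graph_components F. \<exists>!r. r \<in> roots F \<inter> H)"

definition pred_edge :: "('v, 'e) rooted_graph \<Rightarrow> 'v \<Rightarrow> 'e" where
  "pred_edge F x = (THE e. \<exists>r\<in>roots F. \<exists>vs es. is_path F x vs (e # es) r)"

definition is_child :: "('v, 'e) rooted_graph \<Rightarrow> 'v \<Rightarrow> 'v \<Rightarrow> bool" where
  "is_child F x y \<longleftrightarrow> y \<in> verts F - roots F \<and> x \<noteq> y \<and> ends F (pred_edge F y) = {x, y}"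

section \<open>Colored blossom forests\<close>

definition colored_blossom_forest ::
  "('v, 'e) mgraph \<Rightarrow> ('e \<Rightarrow> 'c) \<Rightarrow> 'v set \<Rightarrow>
     'v set \<times> 'v set set \<times> ('v set, 'e) rooted_graph \<Rightarrow> bool" where
  "colored_blossom_forest G col S = (\<lambda>(I, \<pi>, F).
     S \<subseteq> I \<and> I \<subseteq> verts G \<and> partition_on I \<pi> \<and>
     rooted_forest F \<and> is_subgraph F (contract (induced G I) \<pi>) \<and> verts F = \<pi> \<and>
     card (graph_components F) = card S \<and> roots F = block \<pi> ` S \<and>
     (\<forall>s\<in>S. blossom (induced G (block \<pi> s)) col s) \<and>
     (\<forall>v\<in>I. block \<pi> v \<notin> roots F \<and> card (block \<pi> v) = 1 \<longrightarrow>
        (\<forall>y. \<forall>f\<in>edges F. is_child F (block \<pi> v) y \<and> ends F f = {block \<pi> v, y} \<longrightarrow>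
           col f \<noteq> col (pred_edge F (block \<pi> v)))) \<and>
     (\<forall>v\<in>I. block \<pi> v \<notin> roots F \<and> card (block \<pi> v) \<ge> 2 \<longrightarrow>
        (\<forall>u \<in> block \<pi> v \<inter> ends G (pred_edge F (block \<pi> v)).
           c_blossom (induced G (block \<pi> v)) col (col (pred_edge F (block \<pi> v))) u)))"

definition forest_less ::
  "'v set \<times> 'v set set \<times> ('v set, 'e) rooted_graph \<Rightarrow>
   'v set \<times> 'v set set \<times> ('v set, 'e) rooted_graph \<Rightarrow> bool" where
  "forest_less = (\<lambda>(I, \<pi>, F) (I', \<pi>', F').
     I \<subset> I' \<or> (I = I' \<and> (\<forall>B\<in>\<pi>. \<exists>B'\<in>\<pi>'. B \<subseteq> B') \<and> \<pi> \<noteq> \<pi>'))"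

definition maximal_cbf ::
  "('v, 'e) mgraph \<Rightarrow> ('e \<Rightarrow> 'c) \<Rightarrow> 'v set \<Rightarrow>
     'v set \<times> 'v set set \<times> ('v set, 'e) rooted_graph \<Rightarrow> bool" where
  "maximal_cbf G col S T \<longleftrightarrow> colored_blossom_forest G col S T \<and>
     \<not> (\<exists>T'. colored_blossom_forest G col S T' \<and> forest_less T T')"

definition inner_vertices ::
  "'v set \<times> 'v set set \<times> ('v set, 'e) rooted_graph \<Rightarrow> 'v set" where
  "inner_vertices = (\<lambda>(I, \<pi>, F). {v \<in> I. card (block \<pi> v) = 1 \<and> block \<pi> v \<notin> roots F})"

end

theory Submission
  imports Defs
begin

text \<open>
  Call an edge free at an endpoint \<open>w \<in> I\<close> if \<open>w\<close> is not an inner vertex, or the color of the edge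
  differs from that of the predecessor edge of \<open>w\<close>. From a free endpoint one can continue
  alternatingly through the blossoms up to the root of its tree. By maximality, an edge leaving
  \<open>I\<close> is not free at its endpoint in \<open>I\<close>, since the forest could be grown along it. If an edge joins
  two blocks and is free at both endpoints, then it either joins different trees, which gives an
  alternating trail connecting two terminals, or it closes a cycle in a tree, and then the blocks of
  this cycle can be merged into one blossom, or it is a forest edge. A forest edge between two
  blossoms could be contracted as well, so the forest edges that are free at both endpoints are the
  predecessor edges of blossoms whose parent is an inner vertex. As mismatched edges are free at
  each endpoint in \<open>I\<close>, these are the only mismatched edges; and a component of \<open>G - A\<close> is disjoint
  from \<open>I\<close> or contained in a single block.
\<close>

section \<open>Walks and paths\<close>

text \<open>To have two trails whose first edges differ in color is the same as to have, for every
  color \<open>d\<close>, a trail whose first edge avoids \<open>d\<close>. In this form trails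
  compose: the color of an edge joining two vertex-disjoint pieces is the constraint at the end of
  one and at the start of the other. The obstacle to merging the blocks of a cycle is an inner
  vertex on it, whose way up the tree fails for exactly one \<open>d\<close>, the color of its
  predecessor edge. For this \<open>d\<close> the trail has to start downwards and go round the
  cycle through the new edge. If the top of the cycle is itself an inner vertex, the whole cycle has
  to be traversed; this is the closed trail required at the base of a \<open>c\<close>-blossom. The
  order on forests compares only vertex sets and partitions, so each contradiction to maximality
  needs just some forest on the new data. Parent functions with decreasing ranks make such a forest
  checkable block by block.\<close>

lemma distinct_adj_splice:
  "distinct_adj (xs @ [c]) \<Longrightarrow> distinct_adj (c # ys) \<Longrightarrow> distinct_adj (xs @ c # ys)"
  by (auto simp: distinct_adj_append_iff)

text \<open>The start and the edges determine the vertex list, so dropping it loses nothing and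
  turns concatenation and reversal into operations on edge lists.\<close>

definition edge_walk :: "('v, 'e, 'x) mgraph_scheme \<Rightarrow> 'v \<Rightarrow> 'e list \<Rightarrow> 'v \<Rightarrow> bool" where
  "edge_walk G u es v \<longleftrightarrow> (\<exists>vs. is_walk G u vs es v)"

lemma is_walk_Nil [simp]: "is_walk G u vs [] v \<longleftrightarrow> vs = [u] \<and> v = u \<and> u \<in> verts G"
  by (auto simp: is_walk_def length_Suc_conv)

lemma is_walk_Cons:
  "is_walk G u vs (e # es) v \<longleftrightarrow>
     (\<exists>w vs'. vs = u # vs' \<and> u \<in> verts G \<and> e \<in> edges G \<and> ends G e = {u, w} \<and> is_walk G w vs' es v)"
proof (cases "length vs = Suc (Suc (length es)) \<and> hd vs = u")
  case True
  then obtain w ws where vs: "vs = u # w # ws" "length ws = length es"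
    by (auto simp: length_Suc_conv)
  have "(\<forall>j<Suc (length es). ends G ((e # es) ! j) = {(u # w # ws) ! j, (w # ws) ! j}) \<longleftrightarrow>
    ends G e = {u, w} \<and> (\<forall>j<length es. ends G (es ! j) = {(w # ws) ! j, ws ! j})"
    by (simp add: All_less_Suc2)
  with vs show ?thesis
    by (auto simp: is_walk_def)
qed (auto simp: is_walk_def)

lemma is_walk_snoc:
  "is_walk G u vs es v \<Longrightarrow> f \<in> edges G \<Longrightarrow> ends G f = {v, w} \<Longrightarrow> w \<in> verts G \<Longrightarrow>
     is_walk G u (vs @ [w]) (es @ [f]) w"
  by (induction es arbitrary: u vs) (auto simp: is_walk_Cons, blast)

lemma edge_walk_Nil [simp]: "edge_walk G u [] v \<longleftrightarrow> v = u \<and> u \<in> verts G"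
  by (auto simp: edge_walk_def)

lemma edge_walk_Cons [simp]:
  "edge_walk G u (e # es) v \<longleftrightarrow>
     u \<in> verts G \<and> e \<in> edges G \<and> (\<exists>w. ends G e = {u, w} \<and> edge_walk G w es v)"
  by (auto simp: edge_walk_def is_walk_Cons)

lemma edge_walk_start: "edge_walk G u es v \<Longrightarrow> u \<in> verts G"
  by (cases es) auto

lemma edge_walk_end: "edge_walk G u es v \<Longrightarrow> v \<in> verts G"
  by (induction es arbitrary: u) auto

lemma edge_walk_append:
  "edge_walk G u (es @ fs) v \<longleftrightarrow> (\<exists>w. edge_walk G u es w \<and> edge_walk G w fs v)"
  by (induction es arbitrary: u) (auto dest: edge_walk_start)

lemma edge_walk_rev: "edge_walk G u es v \<Longrightarrow> edge_walk G v (rev es) u"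
proof (induction es arbitrary: u)
  case (Cons e es)
  then obtain w where "ends G e = {u, w}" "edge_walk G w es v" "u \<in> verts G" "e \<in> edges G"
    by auto
  with Cons.IH[of w] show ?case
    by (auto simp: edge_walk_append insert_commute dest: edge_walk_start)
qed auto

lemma edge_walk_edges: "edge_walk G u es v \<Longrightarrow> set es \<subseteq> edges G"
  by (induction es arbitrary: u) auto

lemma component_of_iff_edge_walk: "w \<in> component_of G v \<longleftrightarrow> (\<exists>es. edge_walk G v es w)"
  by (auto simp: component_of_def edge_walk_def)

lemma component_of_eq:
  assumes "w \<in> component_of G v"
  shows "component_of G w = component_of G v"
proof -
  obtain es where "edge_walk G v es w"
    using assms by (auto simp: component_of_iff_edge_walk)
  then have "(\<exists>fs. edge_walk G w fs x) \<longleftrightarrow> (\<exists>fs. edge_walk G v fs x)" for x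
    using edge_walk_append edge_walk_rev by metis
  then show ?thesis
    by (simp add: component_of_iff_edge_walk set_eq_iff)
qed

lemma component_of_subset:
  assumes "v \<in> U"
    and "\<And>e x y. e \<in> edges G \<Longrightarrow> ends G e = {x, y} \<Longrightarrow> x \<in> U \<Longrightarrow> y \<in> U"
  shows "component_of G v \<subseteq> U"
proof -
  have "edge_walk G x es w \<Longrightarrow> x \<in> U \<Longrightarrow> w \<in> U" for x es w
  proof (induction es arbitrary: x)
    case (Cons e es)
    then obtain y where "e \<in> edges G" "ends G e = {x, y}" "edge_walk G y es w" by auto
    with Cons.IH assms(2) Cons.prems(2) show ?case by blast
  qed auto
  with assms(1) show ?thesis
    by (auto simp: component_of_iff_edge_walk)
qed

section \<open>Paths and cycles\<close>

lemma is_path_Nil [simp]: "is_path G u vs [] v \<longleftrightarrow> vs = [u] \<and> v = u \<and> u \<in> verts G"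
  by (auto simp: is_path_def)

lemma is_path_Cons:
  "is_path G u vs (e # es) v \<longleftrightarrow>
     (\<exists>w vs'. vs = u # vs' \<and> u \<notin> set vs' \<and> u \<in> verts G \<and> e \<in> edges G \<and> ends G e = {u, w} \<and>
        is_path G w vs' es v)"
  by (auto simp: is_path_def is_walk_Cons)

lemma is_path_start: "is_path G u vs es v \<Longrightarrow> u \<in> set vs"
  by (cases es) (auto simp: is_path_Cons)

lemma is_path_end: "is_path G u vs es v \<Longrightarrow> v \<in> set vs"
  by (induction es arbitrary: u vs) (auto simp: is_path_Cons)

lemma is_path_edge_walk: "is_path G u vs es v \<Longrightarrow> edge_walk G u es v"
  by (auto simp: is_path_def edge_walk_def)

lemma is_path_ends: "is_path G u vs es v \<Longrightarrow> e \<in> set es \<Longrightarrow> ends G e \<subseteq> set vs"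
proof (induction es arbitrary: u vs)
  case (Cons a es)
  then obtain w vs' where "vs = u # vs'" "ends G a = {u, w}" "is_path G w vs' es v"
    by (auto simp: is_path_Cons)
  with Cons.IH[of w vs'] Cons.prems(2) is_path_start[of G w vs' es v] show ?case
    by auto
qed auto

lemma is_path_distinct: "is_path G u vs es v \<Longrightarrow> distinct es"
  by (induction es arbitrary: u vs) (auto simp: is_path_Cons dest: is_path_ends)

lemma is_path_suffix:
  "is_path G u vs es v \<Longrightarrow> x \<in> set vs \<Longrightarrow> \<exists>vs' es'. is_path G x vs' es' v \<and> set es' \<subseteq> set es"
proof (induction es arbitrary: u vs)
  case (Cons e es)
  then obtain w vs' where *: "vs = u # vs'" "is_path G w vs' es v"
    by (auto simp: is_path_Cons)
  show ?case
  proof (cases "x = u")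
    case True
    with Cons.prems show ?thesis by blast
  next
    case False
    with * Cons.prems Cons.IH[of w vs'] show ?thesis by auto
  qed
qed auto

lemma is_path_prefix:
  "is_path G u vs es v \<Longrightarrow> x \<in> set vs \<Longrightarrow>
     \<exists>vs' es' es''. is_path G u vs' es' x \<and> es = es' @ es'' \<and> set vs' \<subseteq> set vs"
proof (induction es arbitrary: u vs)
  case (Cons e es)
  then obtain w vs' where *: "vs = u # vs'" "u \<notin> set vs'" "u \<in> verts G" "e \<in> edges G"
    "ends G e = {u, w}" "is_path G w vs' es v"
    by (auto simp: is_path_Cons)
  show ?case
  proof (cases "x = u")
    case True
    with * have "is_path G u [u] [] x" "e # es = [] @ e # es" "set [u] \<subseteq> set vs"
      by auto
    then show ?thesis by blast
  next
    case False
    with * Cons.prems have "x \<in> set vs'" by auto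
    from Cons.IH[OF *(6) this] obtain ws fs gs where
      "is_path G w ws fs x" "es = fs @ gs" "set ws \<subseteq> set vs'" by blast
    with * have "is_path G u (u # ws) (e # fs) x" "e # es = (e # fs) @ gs" "set (u # ws) \<subseteq> set vs"
      by (auto simp: is_path_Cons)
    then show ?thesis by blast
  qed
qed auto

text \<open>Shortcuts only delete edges. Recording this shows that an edge avoided by the walk is
  avoided by the path, as \<open>edge_walk_closes_cycle\<close> requires.\<close>

lemma edge_walk_imp_path:
  "edge_walk G u es v \<Longrightarrow> \<exists>vs fs. is_path G u vs fs v \<and> set fs \<subseteq> set es"
proof (induction es arbitrary: u)
  case (Cons e es)
  then obtain w where w: "u \<in> verts G" "e \<in> edges G" "ends G e = {u, w}" "edge_walk G w es v"
    by auto
  from Cons.IH[OF w(4)] obtain vs fs where p: "is_path G w vs fs v" "set fs \<subseteq> set es"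
    by blast
  show ?case
  proof (cases "u \<in> set vs")
    case True
    with is_path_suffix[OF p(1)] obtain vs' fs' where "is_path G u vs' fs' v" "set fs' \<subseteq> set fs"
      by blast
    with p(2) have "is_path G u vs' fs' v" "set fs' \<subseteq> set (e # es)" by auto
    then show ?thesis by blast
  next
    case False
    with p w have "is_path G u (u # vs) (e # fs) v" "set (e # fs) \<subseteq> set (e # es)"
      by (auto simp: is_path_Cons)
    then show ?thesis by blast
  qed
qed auto

lemma path_closes_cycle:
  assumes "is_path G x vs es y" "f \<in> edges G" "ends G f = {x, y}" "f \<notin> set es"
  shows "\<exists>vs es. is_cycle G vs es"
proof -
  have w: "is_walk G x vs es y" "distinct vs"
    using assms(1) by (auto simp: is_path_def)
  then have vs: "vs \<noteq> []" "hd vs = x"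
    by (auto simp: is_walk_def)
  have "x \<in> verts G" using w(1) vs(1,2) by (auto simp: is_walk_def)
  then have "is_walk G x (vs @ [x]) (es @ [f]) x"
    using is_walk_snoc[OF w(1) assms(2)] assms(3) by (simp add: insert_commute)
  moreover have "distinct (tl vs @ [x])"
    using w(2) vs(1,2) by (cases vs) auto
  ultimately have "is_cycle G (vs @ [x]) (es @ [f])"
    using assms(4) is_path_distinct[OF assms(1)] vs by (auto simp: is_cycle_def is_trail_def)
  then show ?thesis by blast
qed

lemma edge_walk_closes_cycle:
  assumes "edge_walk G x es y" "f \<in> edges G" "ends G f = {x, y}" "f \<notin> set es"
  shows "\<exists>vs es. is_cycle G vs es"
  using edge_walk_imp_path[OF assms(1)] path_closes_cycle[OF _ assms(2,3)] assms(4) by blast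

section \<open>Rooted forests by parent functions\<close>

text \<open>Data that can be checked vertex by vertex; acyclicity and the unique root of each
  component follow from the strict decrease of \<open>rk\<close> along \<open>par\<close>.\<close>

locale parent_forest =
  fixes F :: "('v, 'e) rooted_graph" and pe :: "'v \<Rightarrow> 'e" and par :: "'v \<Rightarrow> 'v" and rk :: "'v \<Rightarrow> nat"
  assumes finite_verts: "finite (verts F)"
    and roots_subset: "roots F \<subseteq> verts F"
    and edges_eq: "edges F = pe ` (verts F - roots F)"
    and ends_pe: "x \<in> verts F - roots F \<Longrightarrow> ends F (pe x) = {x, par x}"
    and par_verts: "x \<in> verts F - roots F \<Longrightarrow> par x \<in> verts F"
    and rk_par: "x \<in> verts F - roots F \<Longrightarrow> rk (par x) < rk x"
begin

lemma multigraph: "multigraph F"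
proof -
  have "card (ends F (pe x)) = 2" if "x \<in> verts F - roots F" for x
    using ends_pe[OF that] rk_par[OF that] by (cases "par x = x") auto
  then show ?thesis
    using finite_verts ends_pe par_verts by (auto simp: multigraph_def edges_eq)
qed

lemma edge_cases:
  assumes "e \<in> edges F" "ends F e = {x, y}"
  obtains "x \<in> verts F - roots F" "e = pe x" "par x = y" "rk y < rk x"
  | "y \<in> verts F - roots F" "e = pe y" "par y = x" "rk x < rk y"
proof -
  obtain z where "z \<in> verts F - roots F" "e = pe z"
    using assms(1) by (auto simp: edges_eq)
  with ends_pe[of z] rk_par[of z] assms(2) that show thesis
    by (auto simp: doubleton_eq_iff)
qed

text \<open>At a vertex of largest rank on a closed trail both incident edges lead to its parent, so
  they are the same edge, against distinctness.\<close>

lemma no_cycle: "\<not> is_cycle F vs es"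
proof
  assume "is_cycle F vs es"
  then have c: "es \<noteq> []" "is_walk F (hd vs) vs es (hd vs)" "distinct es"
    by (auto simp: is_cycle_def is_trail_def)
  let ?n = "length es"
  have len: "length vs = Suc ?n" using c(2) by (simp add: is_walk_def)
  then have "vs \<noteq> []" by auto
  then have vs0: "vs ! ?n = vs ! 0"
    using c(2) len last_conv_nth[of vs] hd_conv_nth[of vs] by (simp add: is_walk_def)
  have es: "es ! i \<in> edges F" "ends F (es ! i) = {vs ! i, vs ! Suc i}" if "i < ?n" for i
    using c(2) that by (auto simp: is_walk_def)
  obtain j where j: "j < ?n" "\<And>i. i < ?n \<Longrightarrow> rk (vs ! i) \<le> rk (vs ! j)"
  proof -
    let ?A = "(\<lambda>i. rk (vs ! i)) ` {..<?n}"
    have "Max ?A \<in> ?A" using c(1) by (intro Max_in) auto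
    then obtain j where "j < ?n" "Max ?A = rk (vs ! j)" by auto
    moreover have "rk (vs ! i) \<le> Max ?A" if "i < ?n" for i using that by (intro Max_ge) auto
    ultimately show thesis using that by metis
  qed
  have le: "rk (vs ! i) \<le> rk (vs ! j)" if "i \<le> ?n" for i
    using that j(2)[of i] j(2)[of 0] vs0 c(1) by (cases "i = ?n") auto
  have top: "es ! i = pe (vs ! j)" if "i < ?n" "vs ! i = vs ! j \<or> vs ! Suc i = vs ! j" for i
    using edge_cases[OF es(1,2)[OF that(1)]]
  proof cases
    case 1
    then show ?thesis using that le[of i] by (metis less_imp_le_nat not_less)
  next
    case 2
    then show ?thesis using that le[of "Suc i"] by (metis Suc_leI not_less)
  qed
  show False
  proof (cases j)
    \<comment> \<open>The edge before position 0 is the last one. If it equals the edge at 0, the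
      trail is a loop, which the ranks exclude.\<close>
    case 0
    have "es ! 0 = es ! (?n - 1)"
      using top[of 0] top[of "?n - 1"] c(1) 0 vs0 by auto
    with c(1,3) have "?n = 1"
      by (metis One_nat_def diff_less length_greater_0_conv nth_eq_iff_index_eq zero_less_one Suc_pred)
    then show ?thesis
      using edge_cases[OF es(1,2)[of 0]] vs0 by auto
  next
    case (Suc i)
    then have "es ! i = es ! j"
      using top[of i] top[of j] j(1) by auto
    with c(3) j(1) Suc show ?thesis
      by (simp add: nth_eq_iff_index_eq)
  qed
qed

text \<open>A path that avoids the parent of its start can only move to a child, whose parent is
  avoided by the rest of the path. So it keeps going down and ends at a non-root.\<close>

lemma path_descends:
  assumes "is_path F y vs es r" "y \<in> verts F - roots F" "par y \<notin> set vs"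
  shows "r \<notin> roots F"
  using assms
proof (induction es arbitrary: y vs)
  case (Cons f fs)
  then obtain z vs' where *: "vs = y # vs'" "y \<notin> set vs'" "f \<in> edges F" "ends F f = {y, z}"
    "is_path F z vs' fs r"
    by (auto simp: is_path_Cons)
  from *(3,4) show ?case
  proof (cases rule: edge_cases)
    case 1
    with Cons.prems * show ?thesis by (auto dest: is_path_start)
  next
    case 2
    with Cons.IH[OF *(5)] * show ?thesis by auto
  qed
qed auto

text \<open>If the first edge led to a child, the rest of the path would avoid that child's parent
  \<open>x\<close> and, by \<open>path_descends\<close>, could not end in a root.\<close>

lemma path_to_root_first:
  assumes "is_path F x vs (e # es) r" "r \<in> roots F"
  shows "x \<notin> roots F \<and> e = pe x"
proof -
  obtain z vs' where *: "vs = x # vs'" "x \<notin> set vs'" "e \<in> edges F" "ends F e = {x, z}"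
    "is_path F z vs' es r"
    using assms(1) by (auto simp: is_path_Cons)
  from *(3,4) show ?thesis
  proof (cases rule: edge_cases)
    case 2
    with path_descends[OF *(5)] * assms(2) show ?thesis by auto
  qed auto
qed

text \<open>The rank bound shows that \<open>x\<close> is not on the path obtained for
  \<open>par x\<close>, so that it can be prepended.\<close>

lemma path_to_root:
  assumes "x \<in> verts F"
  shows "\<exists>r\<in>roots F. \<exists>vs es. is_path F x vs es r \<and> (\<forall>y\<in>set vs. rk y \<le> rk x)"
  using assms
proof (induction "rk x" arbitrary: x rule: less_induct)
  case less
  show ?case
  proof (cases "x \<in> roots F")
    case True
    with less.prems show ?thesis by (intro bexI[of _ x] exI[of _ "[x]"] exI[of _ "[]"]) auto
  next
    case False
    then have x: "x \<in> verts F - roots F" using less.prems by auto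
    from less.hyps[OF rk_par[OF x] par_verts[OF x]] obtain r vs es where
      *: "r \<in> roots F" "is_path F (par x) vs es r" "\<forall>y\<in>set vs. rk y \<le> rk (par x)" by blast
    with rk_par[OF x] have "x \<notin> set vs" by auto
    with * x ends_pe[OF x] have "is_path F x (x # vs) (pe x # es) r"
      by (auto simp: is_path_Cons edges_eq)
    with * rk_par[OF x] show ?thesis
      by (intro bexI[of _ r] exI[of _ "x # vs"] exI[of _ "pe x # es"]) auto
  qed
qed

lemma pred_edge_eq:
  assumes "x \<in> verts F - roots F"
  shows "pred_edge F x = pe x"
  unfolding pred_edge_def
proof (rule the_equality)
  obtain r vs es where *: "r \<in> roots F" "is_path F x vs es r"
    using path_to_root assms by blast
  with assms obtain e es' where "es = e # es'" by (cases es) auto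
  with * path_to_root_first show "\<exists>r\<in>roots F. \<exists>vs es. is_path F x vs (pe x # es) r"
    by blast
qed (use path_to_root_first in blast)

lemma walk_between_roots:
  assumes "edge_walk F r es r'" "r \<in> roots F" "r' \<in> roots F"
  shows "r = r'"
proof -
  obtain vs fs where "is_path F r vs fs r'"
    using edge_walk_imp_path[OF assms(1)] by blast
  with assms(2,3) path_to_root_first[of r vs _ _ r'] show ?thesis
    by (cases fs) auto
qed

lemma component_root:
  assumes "x \<in> verts F"
  shows "\<exists>!r. r \<in> roots F \<inter> component_of F x"
proof -
  obtain r where "r \<in> roots F \<inter> component_of F x"
    using path_to_root[OF assms] by (auto simp: component_of_iff_edge_walk dest: is_path_edge_walk)
  moreover have "r' = r''" if "r' \<in> roots F \<inter> component_of F x" "r'' \<in> roots F \<inter> component_of F x" for r' r''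
    using that walk_between_roots
    by (auto simp: component_of_iff_edge_walk) (metis edge_walk_append edge_walk_rev)
  ultimately show ?thesis by blast
qed

lemma rooted_forest: "rooted_forest F"
  unfolding rooted_forest_def graph_components_def
  using multigraph no_cycle roots_subset component_root by blast

lemma card_components: "card (graph_components F) = card (roots F)"
proof -
  have "graph_components F = component_of F ` roots F"
  proof
    show "graph_components F \<subseteq> component_of F ` roots F"
    proof
      fix H assume "H \<in> graph_components F"
      then obtain x where "x \<in> verts F" "H = component_of F x"
        by (auto simp: graph_components_def)
      moreover obtain r where "r \<in> roots F" "r \<in> component_of F x"
        using component_root[OF \<open>x \<in> verts F\<close>] by blast
      moreover have "component_of F r = component_of F x"
        by (rule component_of_eq) fact
      ultimately show "H \<in> component_of F ` roots F" by (intro image_eqI[of _ _ r]) auto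
    qed
  qed (use roots_subset in \<open>auto simp: graph_components_def\<close>)
  moreover have "inj_on (component_of F) (roots F)"
  proof (rule inj_onI)
    fix r r' assume r: "r \<in> roots F" "r' \<in> roots F" "component_of F r = component_of F r'"
    have "edge_walk F r' [] r'" using r(2) roots_subset by auto
    then have "r' \<in> component_of F r" unfolding r(3) component_of_iff_edge_walk by blast
    then obtain es where "edge_walk F r es r'" unfolding component_of_iff_edge_walk ..
    with r(1,2) show "r = r'" by (intro walk_between_roots)
  qed
  ultimately show ?thesis by (simp add: card_image)
qed

end

text \<open>The rank is the distance to the root. Its value 0 at the roots is kept for the
  simultaneous ascent in \<open>chain_to_root_or_meet\<close>.\<close>

lemma rooted_forest_imp_parent_forest:
  assumes "rooted_forest F"
  shows "\<exists>par rk. parent_forest F (pred_edge F) par rk \<and> (\<forall>r\<in>roots F. rk r = 0)"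
proof -
  have mg: "multigraph F" and acyc: "\<And>vs es. \<not> is_cycle F vs es" and roots: "roots F \<subseteq> verts F"
    and uniq: "\<And>x. x \<in> verts F \<Longrightarrow> \<exists>!r. r \<in> roots F \<inter> component_of F x"
    using assms by (auto simp: rooted_forest_def graph_components_def)
  have first_unique: "e = e'"
    if p: "is_path F x vs (e # es) r" "r \<in> roots F" and q: "is_path F x vs' (e' # es') r'" "r' \<in> roots F"
    for x vs e es r vs' e' es' r'
  proof (rule ccontr)
    assume "e \<noteq> e'"
    obtain y ws where y: "x \<notin> set ws" "x \<in> verts F" "e \<in> edges F" "ends F e = {x, y}" "is_path F y ws es r"
      using p(1) by (auto simp: is_path_Cons)
    obtain y' ws' where y': "x \<notin> set ws'" "e' \<in> edges F" "ends F e' = {x, y'}" "is_path F y' ws' es' r'"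
      using q(1) by (auto simp: is_path_Cons)
    have "r \<in> component_of F x" "r' \<in> component_of F x"
      using p(1) q(1) is_path_edge_walk by (fastforce simp: component_of_iff_edge_walk)+
    with uniq[OF y(2)] p(2) q(2) have [simp]: "r' = r" by blast
    have "edge_walk F x (e' # es') r"
      using is_path_edge_walk[OF q(1)] by simp
    moreover have "edge_walk F r (rev es) y"
      using is_path_edge_walk[OF y(5)] by (rule edge_walk_rev)
    \<comment> \<open>Up to the root by the second path and back down the first one to
      \<open>y\<close>: a walk avoiding \<open>e\<close>, with which \<open>e\<close> closes a
      cycle.\<close>
    ultimately have "edge_walk F x ((e' # es') @ rev es) y"
      unfolding edge_walk_append by blast
    moreover have "e \<notin> set es" "e \<notin> set es'"
      using is_path_ends[OF y(5), of e] is_path_ends[OF y'(4), of e] y(1,4) y'(1) by blast+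
    then have "e \<notin> set ((e' # es') @ rev es)"
      using \<open>e \<noteq> e'\<close> by simp
    ultimately show False
      using edge_walk_closes_cycle[OF _ y(3,4)] acyc by blast
  qed
  have pred: "pred_edge F x = e" if "is_path F x vs (e # es) r" "r \<in> roots F" for x vs e es r
    unfolding pred_edge_def
  proof (rule the_equality)
    show "\<exists>r\<in>roots F. \<exists>vs es. is_path F x vs (e # es) r" using that by blast
  qed (use that first_unique[OF _ _ that] in blast)
  have ex_path: "\<exists>r\<in>roots F. \<exists>vs es. is_path F x vs es r" if "x \<in> verts F" for x
  proof -
    from uniq[OF that] obtain r where r: "r \<in> roots F" "r \<in> component_of F x"
      by blast
    then obtain es where "edge_walk F x es r"
      unfolding component_of_iff_edge_walk by blast
    from edge_walk_imp_path[OF this] r(1) show ?thesis by blast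
  qed
  define rk where "rk x = (LEAST n. \<exists>r\<in>roots F. \<exists>vs es. is_path F x vs es r \<and> length es = n)" for x
  have rk_le: "rk x \<le> length es" if "is_path F x vs es r" "r \<in> roots F" for x vs es r
    unfolding rk_def using that by (intro Least_le) blast
  have rk_ex: "\<exists>r\<in>roots F. \<exists>vs es. is_path F x vs es r \<and> length es = rk x" if "x \<in> verts F" for x
    unfolding rk_def by (rule LeastI_ex) (use ex_path[OF that] in blast)
  have step: "\<exists>y. pred_edge F x \<in> edges F \<and> ends F (pred_edge F x) = {x, y} \<and> y \<in> verts F \<and> rk y < rk x"
    if x: "x \<in> verts F - roots F" for x
  proof -
    obtain r vs es where *: "r \<in> roots F" "is_path F x vs es r" "length es = rk x"
      using rk_ex[of x] x by blast
    with x obtain e es' where es: "es = e # es'" by (cases es) auto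
    then obtain y vs' where y: "e \<in> edges F" "ends F e = {x, y}" "is_path F y vs' es' r"
      using * by (auto simp: is_path_Cons)
    have "y \<in> verts F" using edge_walk_start[OF is_path_edge_walk[OF y(3)]] .
    moreover have "pred_edge F x = e" using pred * es by blast
    moreover have "rk y < rk x" using rk_le[OF y(3) *(1)] *(3) es by simp
    ultimately show ?thesis using y by (intro exI[of _ y]) simp
  qed
  then obtain par where par: "\<And>x. x \<in> verts F - roots F \<Longrightarrow> pred_edge F x \<in> edges F \<and>
      ends F (pred_edge F x) = {x, par x} \<and> par x \<in> verts F \<and> rk (par x) < rk x"
    by metis
  \<comment> \<open>Take a path from one end \<open>x\<close> to a root. If it misses the other end
    \<open>y\<close>, then \<open>f\<close> can be prepended and is the predecessor edge of
    \<open>y\<close>. Otherwise acyclicity forces \<open>f\<close> onto the part up to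
    \<open>y\<close>, and as \<open>f\<close> touches \<open>x\<close> it is the first edge
    there.\<close>
  have "f \<in> pred_edge F ` (verts F - roots F)" if f: "f \<in> edges F" for f
  proof -
    obtain x y where xy: "ends F f = {x, y}" "x \<noteq> y" "x \<in> verts F" "y \<in> verts F"
    proof -
      from mg f have "ends F f \<subseteq> verts F" "card (ends F f) = 2" by (auto simp: multigraph_def)
      with that show thesis by (auto simp: card_2_iff)
    qed
    obtain r vs es where *: "r \<in> roots F" "is_path F x vs es r"
      using ex_path xy by blast
    show ?thesis
    proof (cases "y \<in> set vs")
      case False
      then have p: "is_path F y (y # vs) (f # es) r"
        using * xy f by (auto simp: is_path_Cons insert_commute)
      moreover have "y \<notin> roots F"
      proof
        assume "y \<in> roots F"
        moreover have "edge_walk F y [] y" "edge_walk F y (f # es) r"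
          using xy is_path_edge_walk[OF p] by auto
        then have "y \<in> component_of F y" "r \<in> component_of F y"
          by (auto simp only: component_of_iff_edge_walk)
        ultimately have "y = r" using uniq[OF xy(4)] *(1) by blast
        then have "y \<in> set vs" using is_path_end[OF *(2)] by simp
        with False show False by simp
      qed
      ultimately show ?thesis using pred * xy by blast
    next
      case True
      with is_path_prefix[OF *(2)] obtain vs' es' es'' where
        pre: "is_path F x vs' es' y" "es = es' @ es''" by blast
      have "f \<in> set es'"
        using path_closes_cycle[OF pre(1) f xy(1)] acyc by blast
      moreover obtain e fs where es': "es' = e # fs"
        using pre xy by (cases es') auto
      moreover have "f \<notin> set fs"
        using pre(1) es' is_path_ends xy by (fastforce simp: is_path_Cons)
      ultimately have "es = f # fs @ es''" using pre by auto
      with * have p: "is_path F x vs (f # fs @ es'') r" by simp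
      moreover have "x \<notin> roots F"
      proof
        assume "x \<in> roots F"
        moreover have "edge_walk F x [] x" "edge_walk F x es r"
          using xy is_path_edge_walk[OF *(2)] by auto
        then have "x \<in> component_of F x" "r \<in> component_of F x"
          by (auto simp only: component_of_iff_edge_walk)
        ultimately have "x = r" using uniq[OF xy(3)] *(1) by blast
        with p show False by (auto simp: is_path_Cons dest: is_path_end)
      qed
      ultimately show ?thesis using pred * xy by blast
    qed
  qed
  then have "edges F = pred_edge F ` (verts F - roots F)"
    using par by blast
  moreover have "rk r = 0" if "r \<in> roots F" for r
    using rk_le[of r "[r]" "[]" r] that roots by auto
  moreover have "finite (verts F)" using mg by (simp add: multigraph_def)
  ultimately show ?thesis
    using par roots by (intro exI[of _ par] exI[of _ rk]) (auto intro!: parent_forest.intro)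
qed

section \<open>Alternating connections inside a vertex set\<close>

text \<open>The lists \<open>ds\<close> and \<open>cs\<close>, of length at most one in all applications, hold the colors of the
  edges preceding and following the trail; with them root blossoms (\<open>cs = []\<close>) and
  \<open>c\<close>-blossoms (\<open>cs = [c]\<close>) are defined by one and the same condition.\<close>

definition alt_conn ::
  "('v, 'e, 'x) mgraph_scheme \<Rightarrow> ('e \<Rightarrow> 'c) \<Rightarrow> 'v set \<Rightarrow> 'v \<Rightarrow> 'v \<Rightarrow> 'c list \<Rightarrow> 'c list \<Rightarrow> bool" where
  "alt_conn G col M x y ds cs \<longleftrightarrow>
     (\<exists>es. edge_walk (induced G M) x es y \<and> distinct es \<and> distinct_adj (ds @ map col es @ cs))"

lemma induced_simps [simp]:
  "verts (induced G M) = verts G \<inter> M"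
  "edges (induced G M) = {e \<in> edges G. ends G e \<subseteq> M}"
  "ends (induced G M) = ends G"
  by (simp_all add: induced_def)

lemma edge_walk_induced_mono:
  "edge_walk (induced G M) x es y \<Longrightarrow> M \<subseteq> N \<Longrightarrow> edge_walk (induced G N) x es y"
  by (induction es arbitrary: x) auto

lemma edge_walk_of_induced: "edge_walk (induced G M) x es y \<Longrightarrow> edge_walk G x es y"
  by (induction es arbitrary: x) auto

lemma edge_walk_induced_edges:
  "edge_walk (induced G M) x es y \<Longrightarrow> e \<in> set es \<Longrightarrow> e \<in> edges G \<and> ends G e \<subseteq> M"
  using edge_walk_edges by fastforce

lemma alt_conn_refl:
  "x \<in> M \<Longrightarrow> x \<in> verts G \<Longrightarrow> distinct_adj (ds @ cs) \<Longrightarrow> alt_conn G col M x x ds cs"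
  unfolding alt_conn_def by (rule exI[of _ "[]"]) auto

lemma alt_conn_mono: "alt_conn G col M x y ds cs \<Longrightarrow> M \<subseteq> N \<Longrightarrow> alt_conn G col N x y ds cs"
  unfolding alt_conn_def using edge_walk_induced_mono[of G M x _ y N] by blast

lemma alt_conn_rev:
  assumes "alt_conn G col M x y ds cs"
  shows "alt_conn G col M y x (rev cs) (rev ds)"
proof -
  obtain es where "edge_walk (induced G M) x es y" "distinct es" "distinct_adj (ds @ map col es @ cs)"
    using assms unfolding alt_conn_def by blast
  then have "edge_walk (induced G M) y (rev es) x" "distinct (rev es)"
    "distinct_adj (rev (ds @ map col es @ cs))"
    by (simp_all only: edge_walk_rev distinct_rev distinct_adj_rev)
  then show ?thesis
    unfolding alt_conn_def by (intro exI[of _ "rev es"]) (simp add: rev_map)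
qed

text \<open>Edges inside disjoint vertex sets are different and \<open>f\<close> lies in neither
  set, so the result is again a trail. Both pieces are bordered by the color of \<open>f\<close>, so
  alternation at the junctions is already recorded.\<close>

lemma alt_conn_comp:
  assumes mg: "multigraph G" and disj: "M \<inter> N = {}"
    and f: "f \<in> edges G" "ends G f = {b, h}"
    and M: "alt_conn G col M x b ds [col f]" and N: "alt_conn G col N h y [col f] cs"
  shows "alt_conn G col (M \<union> N) x y ds cs"
proof -
  obtain es where es: "edge_walk (induced G M) x es b" "distinct es"
    "distinct_adj (ds @ map col es @ [col f])"
    using M unfolding alt_conn_def by blast
  obtain fs where fs: "edge_walk (induced G N) h fs y" "distinct fs"
    "distinct_adj ([col f] @ map col fs @ cs)"
    using N unfolding alt_conn_def by blast
  have b: "b \<in> verts G \<inter> M" using edge_walk_end[OF es(1)] by simp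
  have h: "h \<in> verts G \<inter> N" using edge_walk_start[OF fs(1)] by simp
  have "edge_walk (induced G (M \<union> N)) x es b" "edge_walk (induced G (M \<union> N)) h fs y"
    using edge_walk_induced_mono[OF es(1)] edge_walk_induced_mono[OF fs(1)] by auto
  moreover from this(2) have "edge_walk (induced G (M \<union> N)) b (f # fs) y"
    using f b h by auto
  ultimately have "edge_walk (induced G (M \<union> N)) x (es @ f # fs) y"
    unfolding edge_walk_append by blast
  moreover have "f \<notin> set es" "f \<notin> set fs"
    using edge_walk_induced_edges[OF es(1), of f] edge_walk_induced_edges[OF fs(1), of f] f(2) b h disj
    by auto
  moreover have "e \<notin> set fs" if "e \<in> set es" for e
  proof
    assume "e \<in> set fs"
    then have "ends G e \<subseteq> M \<inter> N" "e \<in> edges G"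
      using edge_walk_induced_edges[OF es(1) that] edge_walk_induced_edges[OF fs(1)] by auto
    then have "ends G e = {}" "card (ends G e) = 2"
      using disj mg by (auto simp: multigraph_def)
    then show False by simp
  qed
  ultimately show ?thesis
    using es(2) fs(2) distinct_adj_splice[of "ds @ map col es" "col f" "map col fs @ cs"] es(3) fs(3)
    unfolding alt_conn_def by (intro exI[of _ "es @ f # fs"]) auto
qed

text \<open>Supplies the closed trail at the base of a \<open>c\<close>-blossom. Both
  \<open>f\<close> and \<open>f'\<close> are incident with \<open>t\<close>, so their being
  different does not follow from disjointness and is assumed.\<close>

lemma alt_conn_close:
  assumes f: "f \<in> edges G" "ends G f = {t, a}" and f': "f' \<in> edges G" "ends G f' = {b, t}"
    and ne: "f \<noteq> f'" and t: "t \<notin> M"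
    and M: "alt_conn G col M a b [col f] [col f']"
    and ds: "distinct_adj (ds @ [col f])" and cs: "distinct_adj (col f' # cs)"
    and tv: "t \<in> verts G"
  shows "alt_conn G col (insert t M) t t ds cs"
proof -
  obtain es where es: "edge_walk (induced G M) a es b" "distinct es"
    "distinct_adj ([col f] @ map col es @ [col f'])"
    using M unfolding alt_conn_def by blast
  have b: "b \<in> verts G \<inter> M" using edge_walk_end[OF es(1)] by simp
  have a: "a \<in> verts G \<inter> M" using edge_walk_start[OF es(1)] by simp
  have "edge_walk (induced G (insert t M)) a es b"
    using edge_walk_induced_mono[OF es(1)] by auto
  moreover have "edge_walk (induced G (insert t M)) b [f'] t"
    using f' b tv by auto
  ultimately have "edge_walk (induced G (insert t M)) a (es @ [f']) t"
    unfolding edge_walk_append by blast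
  then have "edge_walk (induced G (insert t M)) t (f # es @ [f']) t"
    using f a tv by auto
  moreover have "f \<notin> set es" "f' \<notin> set es"
    using edge_walk_induced_edges[OF es(1), of f] edge_walk_induced_edges[OF es(1), of f'] f(2) f'(2) t
    by auto
  moreover have "distinct_adj (ds @ col f # map col es @ col f' # cs)"
    using distinct_adj_splice[OF ds, of "map col es @ [col f']"] es(3)
      distinct_adj_splice[of "ds @ col f # map col es" "col f'" cs] cs by simp
  ultimately show ?thesis
    using es(2) ne unfolding alt_conn_def by (intro exI[of _ "f # es @ [f']"]) auto
qed

section \<open>Blossoms as alternating connections\<close>

lemma int_alternating_iff: "int_alternating col es \<longleftrightarrow> distinct_adj (map col es)"
  by (auto simp: int_alternating_def distinct_adj_conv_nth)

lemma distinct_adj_bordered_iff: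
  assumes "xs \<noteq> []"
  shows "distinct_adj (d # xs @ cs) \<longleftrightarrow>
    distinct_adj xs \<and> d \<noteq> hd xs \<and> distinct_adj (last xs # cs)"
  using assms by (cases cs) (auto simp: distinct_adj_Cons distinct_adj_append_iff)

lemma ex_int_alternating_trail_iff:
  "(\<exists>vs. int_alternating_trail G col u vs es v) \<longleftrightarrow>
     edge_walk G u es v \<and> distinct es \<and> distinct_adj (map col es)"
  by (auto simp: int_alternating_trail_def is_trail_def edge_walk_def int_alternating_iff)

text \<open>Of two different first colors at least one differs from \<open>d\<close>; conversely, a
  second trail arises by choosing \<open>d\<close> as the first color of some trail. Since
  \<open>v \<noteq> u\<close>, all these trails have edges, so \<open>hd\<close> and
  \<open>last\<close> are meaningful, and the closing condition is vacuous.\<close>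

lemma blossom_trails_iff:
  assumes "v \<noteq> u"
  shows "(\<exists>vs es ws fs. alternating_trail (induced G M) col v vs es u \<and>
      alternating_trail (induced G M) col v ws fs u \<and>
      col (hd es) \<noteq> col (hd fs) \<and> distinct_adj (col (last es) # cs) \<and> distinct_adj (col (last fs) # cs))
    \<longleftrightarrow> (\<forall>d. alt_conn G col M v u [d] cs)" (is "?L \<longleftrightarrow> ?R")
proof -
  define P where "P es \<longleftrightarrow> edge_walk (induced G M) v es u \<and> distinct es \<and> distinct_adj (map col es) \<and>
    distinct_adj (col (last es) # cs)" for es
  have ne: "es \<noteq> []" if "edge_walk (induced G M) v es u" for es
    using that assms by auto
  have "?L \<longleftrightarrow> (\<exists>es fs. P es \<and> P fs \<and> col (hd es) \<noteq> col (hd fs))"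
    using assms ex_int_alternating_trail_iff[of "induced G M" col v _ u]
    unfolding P_def alternating_trail_def by (simp del: map_is_Nil_conv) blast
  moreover have conn: "alt_conn G col M v u [d] cs \<longleftrightarrow> (\<exists>es. P es \<and> d \<noteq> col (hd es))" for d
  proof -
    have "distinct_adj ([d] @ map col es @ cs) \<longleftrightarrow>
        distinct_adj (map col es) \<and> d \<noteq> col (hd es) \<and> distinct_adj (col (last es) # cs)"
      if "edge_walk (induced G M) v es u" for es
      using ne[OF that] distinct_adj_bordered_iff[of "map col es" d cs] by (simp add: hd_map last_map)
    then show ?thesis unfolding alt_conn_def P_def by blast
  qed
  moreover have "(\<exists>es fs. P es \<and> P fs \<and> col (hd es) \<noteq> col (hd fs)) \<longleftrightarrow>
      (\<forall>d. \<exists>es. P es \<and> d \<noteq> col (hd es))"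
  proof
    assume *: "\<forall>d. \<exists>es. P es \<and> d \<noteq> col (hd es)"
    obtain es where "P es" using * by blast
    moreover obtain fs where "P fs" "col (hd es) \<noteq> col (hd fs)" using * by blast
    ultimately show "\<exists>es fs. P es \<and> P fs \<and> col (hd es) \<noteq> col (hd fs)" by blast
  qed auto
  ultimately show ?thesis by simp
qed

lemma blossom_iff:
  assumes "M \<subseteq> verts G"
  shows "blossom (induced G M) col u \<longleftrightarrow> u \<in> M \<and> (\<forall>v\<in>M. \<forall>d. alt_conn G col M v u [d] [])"
proof -
  have "verts G \<inter> M = M" using assms by blast
  moreover have "alt_conn G col M u u [d] []" if "u \<in> M" for d
    using that assms by (auto intro: alt_conn_refl)
  ultimately show ?thesis
    unfolding blossom_def using blossom_trails_iff[of _ u G M col "[]"] by (auto simp del: ex_simps)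
qed

text \<open>At \<open>v = u\<close> the empty trail serves every \<open>d\<close> other than
  \<open>c\<close>, and the case \<open>d = c\<close> is exactly the closed-trail condition.\<close>

lemma c_blossom_iff:
  assumes "M \<subseteq> verts G"
  shows "c_blossom (induced G M) col c u \<longleftrightarrow> u \<in> M \<and> (\<forall>v\<in>M. \<forall>d. alt_conn G col M v u [d] [c])"
proof -
  have M: "verts G \<inter> M = M" using assms by blast
  have conn_u: "alt_conn G col M u u [d] [c]" if "u \<in> M" "d \<noteq> c" for d
    using that assms by (auto intro: alt_conn_refl)
  have "(\<exists>vs es. int_alternating_trail (induced G M) col u vs es u \<and> es \<noteq> [] \<and>
        col (hd es) \<noteq> c \<and> col (last es) \<noteq> c) \<longleftrightarrow>
    (\<exists>es. edge_walk (induced G M) u es u \<and> distinct es \<and> distinct_adj (map col es) \<and> es \<noteq> [] \<and>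
        col (hd es) \<noteq> c \<and> col (last es) \<noteq> c)"
    using ex_int_alternating_trail_iff[of "induced G M" col u _ u] by blast
  moreover have "(distinct_adj (map col es) \<and> es \<noteq> [] \<and> col (hd es) \<noteq> c \<and> col (last es) \<noteq> c) \<longleftrightarrow>
      distinct_adj ([c] @ map col es @ [c])" for es
    using distinct_adj_bordered_iff[of "map col es" c "[c]"]
    by (cases "es = []") (auto simp: hd_map last_map)
  ultimately have closed: "(\<exists>vs es. int_alternating_trail (induced G M) col u vs es u \<and> es \<noteq> [] \<and>
        col (hd es) \<noteq> c \<and> col (last es) \<noteq> c) \<longleftrightarrow> alt_conn G col M u u [c] [c]"
    unfolding alt_conn_def by blast
  have two: "(\<exists>vs es ws fs. alternating_trail (induced G M) col v vs es u \<and>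
        alternating_trail (induced G M) col v ws fs u \<and>
        col (hd es) \<noteq> col (hd fs) \<and> col (last es) \<noteq> c \<and> col (last fs) \<noteq> c) \<longleftrightarrow>
      (\<forall>d. alt_conn G col M v u [d] [c])" if "v \<noteq> u" for v
    using blossom_trails_iff[OF that, of G M col "[c]"] by simp
  show ?thesis
    unfolding c_blossom_def closed induced_simps M
  proof (intro conj_cong refl iffI ballI allI conjI impI)
    fix v d
    assume "u \<in> M" and v: "v \<in> M" and "(\<forall>v\<in>M. v \<noteq> u \<longrightarrow>
      (\<exists>vs es ws fs. alternating_trail (induced G M) col v vs es u \<and>
        alternating_trail (induced G M) col v ws fs u \<and>
        col (hd es) \<noteq> col (hd fs) \<and> col (last es) \<noteq> c \<and> col (last fs) \<noteq> c)) \<and>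
      alt_conn G col M u u [c] [c]"
    then show "alt_conn G col M v u [d] [c]"
      using two[of v] conn_u[of d] by (cases "v = u"; cases "d = c") auto
  qed (use two in auto)
qed

section \<open>Blossom forests in terms of the underlying graph\<close>

text \<open>Root blocks are those meeting \<open>S\<close>; on them \<open>pe\<close>, \<open>par\<close>, \<open>lo\<close> and \<open>hi\<close> are junk.
  The decrease of \<open>rk\<close> towards the root encodes acyclicity.\<close>

locale blossom_forest =
  fixes G :: "('v, 'e) mgraph" and col :: "'e \<Rightarrow> 'c" and S I :: "'v set" and \<pi> :: "'v set set"
    and pe :: "'v set \<Rightarrow> 'e" and par :: "'v set \<Rightarrow> 'v set" and lo hi :: "'v set \<Rightarrow> 'v"
    and rk :: "'v set \<Rightarrow> nat"
  assumes mg: "multigraph G" and S_sub: "S \<subseteq> I" and I_sub: "I \<subseteq> verts G"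
    and part: "partition_on I \<pi>"
    and terminal_unique: "B \<in> \<pi> \<Longrightarrow> s \<in> B \<inter> S \<Longrightarrow> t \<in> B \<inter> S \<Longrightarrow> s = t"
    and pe_edges: "B \<in> \<pi> \<Longrightarrow> B \<inter> S = {} \<Longrightarrow> pe B \<in> edges G"
    and pe_ends: "B \<in> \<pi> \<Longrightarrow> B \<inter> S = {} \<Longrightarrow> ends G (pe B) = {lo B, hi B}"
    and lo_in: "B \<in> \<pi> \<Longrightarrow> B \<inter> S = {} \<Longrightarrow> lo B \<in> B"
    and hi_in: "B \<in> \<pi> \<Longrightarrow> B \<inter> S = {} \<Longrightarrow> hi B \<in> par B"
    and par_in: "B \<in> \<pi> \<Longrightarrow> B \<inter> S = {} \<Longrightarrow> par B \<in> \<pi>"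
    and rk_par: "B \<in> \<pi> \<Longrightarrow> B \<inter> S = {} \<Longrightarrow> rk (par B) < rk B"
    and rk_root: "B \<in> \<pi> \<Longrightarrow> B \<inter> S \<noteq> {} \<Longrightarrow> rk B = 0"
    and child_color: "B \<in> \<pi> \<Longrightarrow> B \<inter> S = {} \<Longrightarrow> par B \<inter> S = {} \<Longrightarrow> card (par B) = 1 \<Longrightarrow>
      col (pe B) \<noteq> col (pe (par B))"
    and root_conn: "B \<in> \<pi> \<Longrightarrow> s \<in> B \<inter> S \<Longrightarrow> v \<in> B \<Longrightarrow> alt_conn G col B v s [d] []"
    and outer_conn: "B \<in> \<pi> \<Longrightarrow> B \<inter> S = {} \<Longrightarrow> card B \<noteq> 1 \<Longrightarrow> v \<in> B \<Longrightarrow>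
      alt_conn G col B v (lo B) [d] [col (pe B)]"
begin

text \<open>The vertex at which trails towards the root leave a block. The description is proper
  because a root block contains exactly one terminal.\<close>

definition base :: "'v set \<Rightarrow> 'v" where
  "base B = (if B \<inter> S = {} then lo B else (THE s. s \<in> B \<inter> S))"

text \<open>The color following \<open>base B\<close> on a trail to the root: that of the
  predecessor edge, or none where the trail stops at a terminal.\<close>

definition exits :: "'v set \<Rightarrow> 'c list" where
  "exits B = (if B \<inter> S = {} then [col (pe B)] else [])"

definition inner :: "'v set \<Rightarrow> bool" where
  "inner B \<longleftrightarrow> B \<inter> S = {} \<and> card B = 1"

definition free :: "'v \<Rightarrow> 'c \<Rightarrow> bool" where
  "free v d \<longleftrightarrow> (\<forall>B\<in>\<pi>. v \<in> B \<and> inner B \<longrightarrow> d \<noteq> col (pe B))"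

lemma block_verts: "B \<in> \<pi> \<Longrightarrow> B \<subseteq> verts G"
  using part I_sub by (auto simp: partition_on_def)

lemma block_disjoint: "B \<in> \<pi> \<Longrightarrow> B' \<in> \<pi> \<Longrightarrow> v \<in> B \<Longrightarrow> v \<in> B' \<Longrightarrow> B = B'"
  using part by (auto simp: partition_on_def disjoint_def)

lemma Union_disjoint:
  assumes "M \<subseteq> \<pi>" "N \<subseteq> \<pi>" "M \<inter> N = {}"
  shows "\<Union>M \<inter> \<Union>N = {}"
proof -
  have False if "B \<in> M" "B' \<in> N" "v \<in> B" "v \<in> B'" for B B' v
    using block_disjoint[of B B' v] that assms by blast
  then show ?thesis by blast
qed

lemma block_nonempty: "B \<in> \<pi> \<Longrightarrow> B \<noteq> {}"
  using part by (auto simp: partition_on_def)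

lemma block_subset: "B \<in> \<pi> \<Longrightarrow> B \<subseteq> I"
  using part by (auto simp: partition_on_def)

lemma block_exists: "v \<in> I \<Longrightarrow> \<exists>B\<in>\<pi>. v \<in> B"
  using part by (auto simp: partition_on_def)

lemma finite_block: "B \<in> \<pi> \<Longrightarrow> finite B"
  using finite_subset[OF block_verts] mg unfolding multigraph_def by simp

lemma base_root:
  assumes "B \<in> \<pi>" "s \<in> B" "s \<in> S"
  shows "base B = s"
proof -
  have "(THE t. t \<in> B \<inter> S) = s"
    using assms terminal_unique[OF assms(1)] by (intro the_equality) blast+
  with assms show ?thesis unfolding base_def by auto
qed

lemma inner_eq:
  assumes "B \<in> \<pi>" "inner B"
  shows "B = {lo B}"
proof -
  obtain x where "B = {x}" using assms(2) card_1_singletonE unfolding inner_def by blast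
  with lo_in[OF assms(1)] assms(2) show ?thesis unfolding inner_def by auto
qed

lemma conn_noninner:
  assumes "B \<in> \<pi>" "\<not> inner B" "v \<in> B"
  shows "alt_conn G col B v (base B) [d] (exits B)"
proof (cases "B \<inter> S = {}")
  case True
  then show ?thesis
    using outer_conn assms by (simp add: base_def exits_def inner_def)
next
  case False
  then obtain s where "s \<in> B \<inter> S" by blast
  with root_conn[OF assms(1) this assms(3)] base_root[OF assms(1), of s] show ?thesis
    by (auto simp: exits_def)
qed

text \<open>In an inner block the empty trail must do, and freeness is just what it demands; all
  other blocks are blossoms.\<close>

lemma conn_free:
  assumes "B \<in> \<pi>" "v \<in> B" "free v d"
  shows "alt_conn G col B v (base B) [d] (exits B)"
proof (cases "inner B")
  case True
  then have "B = {lo B}" using inner_eq assms(1) by blast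
  with assms(2) have "v = lo B" by auto
  moreover have "d \<noteq> col (pe B)" using assms True by (auto simp: free_def)
  ultimately show ?thesis
    using True assms block_verts[OF assms(1)]
    by (auto simp: base_def exits_def inner_def intro!: alt_conn_refl)
qed (use conn_noninner assms in blast)

lemma free_noninner: "B \<in> \<pi> \<Longrightarrow> v \<in> B \<Longrightarrow> \<not> inner B \<Longrightarrow> free v d"
  using block_disjoint unfolding free_def by blast

text \<open>The color condition on children of inner vertices, read at the parent: a trail that
  arrives along a predecessor edge can continue upwards.\<close>

lemma free_hi: "B \<in> \<pi> \<Longrightarrow> B \<inter> S = {} \<Longrightarrow> free (hi B) (col (pe B))"
  unfolding free_def
  using child_color[of B] block_disjoint[OF _ par_in _ hi_in, of _ B] by (auto simp: inner_def)

section \<open>Forest paths between blocks\<close>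

lemma par_disjoint: "B \<in> \<pi> \<Longrightarrow> B \<inter> S = {} \<Longrightarrow> B \<inter> par B = {}"
  using block_disjoint[OF _ par_in] rk_par by (metis disjoint_iff less_irrefl)

text \<open>Different blocks sharing a predecessor edge would be parents of each other, against the
  ranks.\<close>

lemma pe_inj:
  assumes "B \<in> \<pi>" "B \<inter> S = {}" "B' \<in> \<pi>" "B' \<inter> S = {}" "pe B = pe B'"
  shows "B = B'"
proof (rule ccontr)
  assume "B \<noteq> B'"
  have "{lo B, hi B} = {lo B', hi B'}" using pe_ends assms by metis
  moreover have "lo B \<noteq> lo B'" using lo_in assms block_disjoint \<open>B \<noteq> B'\<close> by metis
  ultimately have "lo B = hi B'" "lo B' = hi B" by (auto simp: doubleton_eq_iff)
  then have "par B' = B" "par B = B'"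
    using assms lo_in hi_in par_in block_disjoint by metis+
  then show False using rk_par[OF assms(1,2)] rk_par[OF assms(3,4)] by simp
qed

text \<open>The set holds the blocks on the forest path from the first block up to its ancestor, the
  third argument. Disjointness of trails is later derived from disjointness of such sets.\<close>

inductive chain :: "'v set \<Rightarrow> 'v set set \<Rightarrow> 'v set \<Rightarrow> bool" where
  chain_refl: "B \<in> \<pi> \<Longrightarrow> chain B {B} B"
| chain_step: "B \<in> \<pi> \<Longrightarrow> B \<inter> S = {} \<Longrightarrow> chain (par B) M T \<Longrightarrow> chain B (insert B M) T"

lemma chain_blocks: "chain B M T \<Longrightarrow> M \<subseteq> \<pi>"
  by (induction rule: chain.induct) auto

lemma chain_bottom: "chain B M T \<Longrightarrow> B \<in> M"
  by (induction rule: chain.induct) auto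

lemma chain_top: "chain B M T \<Longrightarrow> T \<in> M"
  by (induction rule: chain.induct) auto

lemma chain_par: "chain B M T \<Longrightarrow> X \<in> M \<Longrightarrow> X \<noteq> T \<Longrightarrow> X \<inter> S = {} \<and> par X \<in> M"
  by (induction rule: chain.induct) (auto dest: chain_bottom)

lemma chain_rk_le: "chain B M T \<Longrightarrow> X \<in> M \<Longrightarrow> rk X \<le> rk B"
  by (induction rule: chain.induct) (auto dest: rk_par)

lemma chain_rk_less:
  assumes "chain B M T" "X \<in> M" "X \<noteq> B"
  shows "rk X < rk B"
  using assms
proof (cases rule: chain.cases)
  case (chain_step M')
  then show ?thesis using chain_rk_le[of "par B" M' T X] rk_par[of B] assms(2,3) by auto
qed auto

lemma chain_suffix: "chain B M T \<Longrightarrow> X \<in> M \<Longrightarrow> \<exists>M'. M' \<subseteq> M \<and> chain X M' T"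
proof (induction rule: chain.induct)
  case (chain_step B M T)
  show ?case
  proof (cases "X = B")
    case True
    then show ?thesis using chain.chain_step[OF chain_step.hyps] by blast
  next
    case False
    then show ?thesis using chain_step by blast
  qed
qed (auto intro: chain_refl)

lemma chain_prefix:
  "chain B M T \<Longrightarrow> X \<in> M \<Longrightarrow> X \<noteq> T \<Longrightarrow> \<exists>M'. M' \<subseteq> M - {T} \<and> chain B M' X"
proof (induction rule: chain.induct)
  case (chain_step B M T)
  have "T \<noteq> B"
    using chain_rk_le[OF chain_step.hyps(3) chain_top[OF chain_step.hyps(3)]] rk_par[OF chain_step.hyps(1,2)]
    by auto
  show ?case
  proof (cases "X = B")
    case True
    with chain_refl[OF chain_step.hyps(1)] \<open>T \<noteq> B\<close> show ?thesis by (intro exI[of _ "{B}"]) auto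
  next
    case False
    with chain_step obtain M' where "M' \<subseteq> M - {T}" "chain (par B) M' X" by auto
    with chain.chain_step[OF chain_step.hyps(1,2)] \<open>T \<noteq> B\<close> show ?thesis
      by (intro exI[of _ "insert B M'"]) auto
  qed
qed auto

text \<open>\<open>Z\<close> is the child through which the ascent enters \<open>T\<close>, so
  \<open>pe Z\<close> is the edge of the chain at \<open>T\<close>.\<close>

lemma chain_below_top:
  "chain B M T \<Longrightarrow> B \<noteq> T \<Longrightarrow> \<exists>Z M'. M' \<subseteq> M - {T} \<and> chain B M' Z \<and> Z \<inter> S = {} \<and> par Z = T"
proof (induction rule: chain.induct)
  case (chain_step B M T)
  show ?case
  proof (cases "par B = T")
    case True
    with chain_step chain_refl[of B] show ?thesis by (intro exI[of _ B] exI[of _ "{B}"]) auto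
  next
    case False
    with chain_step obtain Z M' where "M' \<subseteq> M - {T}" "chain (par B) M' Z" "Z \<inter> S = {}" "par Z = T"
      by auto
    with chain.chain_step[OF chain_step.hyps(1,2)] chain_step.prems show ?thesis
      by (intro exI[of _ Z] exI[of _ "insert B M'"]) auto
  qed
qed auto

text \<open>By \<open>free_hi\<close>, a trail leaving a block along its predecessor edge arrives at
  a vertex free for that color. Hence freeness at the start is enough for the whole ascent.\<close>

lemma chain_conn:
  "chain B M T \<Longrightarrow> v \<in> B \<Longrightarrow> free v d \<Longrightarrow> alt_conn G col (\<Union>M) v (base T) [d] (exits T)"
proof (induction arbitrary: v d rule: chain.induct)
  case (chain_refl B)
  then show ?case using conn_free by simp
next
  case (chain_step B M T)
  have "B \<notin> M"
    using chain_rk_le[OF chain_step.hyps(3)] rk_par[OF chain_step.hyps(1,2)] by (metis not_less)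
  then have disj: "B \<inter> \<Union>M = {}"
    using chain_blocks[OF chain_step.hyps(3)] chain_step.hyps(1) block_disjoint by blast
  have "alt_conn G col B v (lo B) [d] [col (pe B)]"
    using conn_free[OF chain_step.hyps(1) chain_step.prems] chain_step.hyps(2)
    by (simp add: base_def exits_def)
  moreover have "alt_conn G col (\<Union>M) (hi B) (base T) [col (pe B)] (exits T)"
    using chain_step.IH hi_in free_hi chain_step.hyps(1,2) by blast
  ultimately have "alt_conn G col (B \<union> \<Union>M) v (base T) [d] (exits T)"
    using alt_conn_comp[OF mg disj pe_edges pe_ends] chain_step.hyps(1,2) by blast
  then show ?case by simp
qed

text \<open>The step up is always made from a block of larger or equal rank. It cannot lie on the
  chain of the other block, whose members after the start have smaller rank, so disjointness is
  preserved.\<close>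

lemma chain_to_root_or_meet:
  assumes "X \<in> \<pi>" "Y \<in> \<pi>"
  shows "(\<exists>M N T. chain X M T \<and> chain Y N T \<and> M \<inter> N = {T}) \<or>
    (\<exists>M N R R'. chain X M R \<and> chain Y N R' \<and> M \<inter> N = {} \<and> R \<inter> S \<noteq> {} \<and> R' \<inter> S \<noteq> {})"
  (is "?P X Y")
  using assms
proof (induction "rk X + rk Y" arbitrary: X Y rule: less_induct)
  case less
  have step: "?P X Y" if XY: "X \<noteq> Y" "X \<inter> S = {}" "rk Y \<le> rk X" "X \<in> \<pi>" "Y \<in> \<pi>" "?P (par X) Y" for X Y
  proof -
    have fresh: "X \<notin> M" "X \<notin> N" if "chain (par X) M T" "chain Y N T'" for M N T T'
      using chain_rk_le[OF that(1), of X] rk_par[OF XY(4,2)] chain_rk_less[OF that(2), of X] XY(1,3)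
      by auto
    from XY(6) show ?thesis
    proof
      assume "\<exists>M N T. chain (par X) M T \<and> chain Y N T \<and> M \<inter> N = {T}"
      then obtain M N T where *: "chain (par X) M T" "chain Y N T" "M \<inter> N = {T}" by blast
      with chain_step[OF XY(4,2)] fresh[OF *(1,2)]
      have "chain X (insert X M) T" "insert X M \<inter> N = {T}" by auto
      with * show ?thesis by blast
    next
      assume "\<exists>M N R R'. chain (par X) M R \<and> chain Y N R' \<and> M \<inter> N = {} \<and> R \<inter> S \<noteq> {} \<and> R' \<inter> S \<noteq> {}"
      then obtain M N R R' where *: "chain (par X) M R" "chain Y N R'" "M \<inter> N = {}"
        "R \<inter> S \<noteq> {}" "R' \<inter> S \<noteq> {}" by blast
      with chain_step[OF XY(4,2)] fresh[OF *(1,2)]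
      have "chain X (insert X M) R" "insert X M \<inter> N = {}" by auto
      with * show ?thesis by blast
    qed
  qed
  have sym: "?P X Y" if "?P Y X" for X Y
    using that
  proof (elim disjE exE conjE)
    fix M N T assume "chain Y M T" "chain X N T" "M \<inter> N = {T}"
    moreover from this have "N \<inter> M = {T}" by (simp add: Int_commute)
    ultimately show ?thesis by blast
  next
    fix M N R R' assume "chain Y M R" "chain X N R'" "M \<inter> N = {}" "R \<inter> S \<noteq> {}" "R' \<inter> S \<noteq> {}"
    moreover from this have "N \<inter> M = {}" by (simp add: Int_commute)
    ultimately show ?thesis by blast
  qed
  \<comment> \<open>If the block of larger rank is a root, both ranks are 0 by
    \<open>rk_root\<close>, and a block of rank 0 has no parent; so both blocks are roots.\<close>
  consider "X = Y" | "X \<noteq> Y" "X \<inter> S = {}" "rk Y \<le> rk X" | "X \<noteq> Y" "Y \<inter> S = {}" "rk X \<le> rk Y"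
    | "X \<noteq> Y" "X \<inter> S \<noteq> {}" "Y \<inter> S \<noteq> {}"
    using rk_root[OF less.prems(1)] rk_root[OF less.prems(2)] rk_par[OF less.prems(1)]
      rk_par[OF less.prems(2)] by (metis le0 nle_le)
  then show ?case
  proof cases
    case 1
    with chain_refl less.prems show ?thesis by (intro disjI1 exI[of _ "{X}"] exI[of _ X]) auto
  next
    case 2
    with less.hyps[of "par X" Y] less.prems rk_par[of X] par_in[of X] have "?P (par X) Y" by simp
    from step[OF 2 less.prems this] show ?thesis .
  next
    case 3
    with less.hyps[of "par Y" X] less.prems rk_par[of Y] par_in[of Y] have "?P (par Y) X" by simp
    from step[OF 3(1)[symmetric] 3(2,3) less.prems(2,1) this] show ?thesis by (rule sym)
  next
    case 4
    with chain_refl[of X] chain_refl[of Y] less.prems show ?thesis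
      by (intro disjI2 exI[of _ "{X}"] exI[of _ "{Y}"] exI[of _ X] exI[of _ Y]) auto
  qed
qed

end

section \<open>Growing and shrinking blossom forests\<close>

context blossom_forest
begin

text \<open>The block \<open>{w}\<close> becomes an inner child of \<open>B\<close>. If
  \<open>B\<close> is inner, freeness of \<open>v\<close> is the color condition on this child;
  being a singleton, \<open>{w}\<close> has no blossom condition to satisfy.\<close>

lemma grow:
  assumes B: "B \<in> \<pi>" "v \<in> B" and w: "w \<in> verts G" "w \<notin> I"
    and e: "e \<in> edges G" "ends G e = {v, w}" and free: "free v (col e)"
  shows "blossom_forest G col S (insert w I) (insert {w} \<pi>) (pe({w} := e)) (par({w} := B))
    (lo({w} := w)) (hi({w} := v)) (rk({w} := Suc (rk B)))"
proof -
  have ne: "X \<noteq> {w}" if "X \<in> \<pi>" for X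
    using block_subset[OF that] w(2) by auto
  have par_ne: "par X \<noteq> {w}" if "X \<in> \<pi>" "X \<inter> S = {}" for X
    using ne par_in that by blast
  have w_S: "{w} \<inter> S = {}" using w S_sub by auto
  have "{w} \<notin> \<pi>" "w \<notin> \<Union>\<pi>"
    using ne block_subset w(2) by blast+
  then have part': "partition_on (insert w I) (insert {w} \<pi>)"
    using part w(2) by (auto simp: partition_on_def disjoint_def)
  have B_ne: "B \<noteq> {w}" using ne B(1) .
  show ?thesis
  proof (unfold_locales, goal_cases)
    case 5
    then show ?case using terminal_unique w_S by auto
  next
    case (12 X)
    then have "X \<in> \<pi>" "X \<noteq> {w}" using w_S by auto
    with 12 rk_root show ?case by simp
  next
    case (13 X)
    show ?case
    proof (cases "X = {w}")
      case True
      with 13 B_ne free B show ?thesis by (auto simp: free_def inner_def)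
    next
      case False
      with 13 have "X \<in> \<pi>" by auto
      with 13 par_ne[of X] child_color[of X] False show ?thesis by auto
    qed
  next
    case 14
    then show ?case using root_conn w_S by auto
  next
    case 15
    then show ?case using outer_conn ne by auto
  qed (use mg S_sub I_sub part' w e B ne B_ne par_ne pe_edges pe_ends lo_in hi_in par_in rk_par
      in \<open>auto simp: insert_commute\<close>)
qed

text \<open>All blocks of \<open>K\<close> lie below \<open>T\<close> within \<open>K\<close>, so
  the merged block inherits predecessor edge, base and rank of \<open>T\<close>, and children of
  blocks in \<open>K\<close> become its children. It is not a singleton and thus imposes no color
  condition on them.\<close>

lemma contract_blocks:
  assumes K: "K \<subseteq> \<pi>" "T \<in> K" "K \<noteq> {T}"
    and up: "\<And>B. B \<in> K \<Longrightarrow> B \<noteq> T \<Longrightarrow> B \<inter> S = {} \<and> par B \<in> K"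
    and conn: "\<And>v d. v \<in> \<Union>K \<Longrightarrow> alt_conn G col (\<Union>K) v (base T) [d] (exits T)"
  shows "blossom_forest G col S I (insert (\<Union>K) (\<pi> - K)) (pe(\<Union>K := pe T))
    (\<lambda>B. if B = \<Union>K then par T else if par B \<in> K then \<Union>K else par B)
    (lo(\<Union>K := lo T)) (hi(\<Union>K := hi T)) (rk(\<Union>K := rk T))"
proof -
  let ?N = "\<Union>K"
  have T: "T \<in> \<pi>" using K by blast
  \<comment> \<open>As \<open>T\<close> has least rank in \<open>K\<close>, its parent lies outside
    \<open>K\<close>, and the children of the merged block still have larger rank than it.\<close>
  have rk_T: "rk T \<le> rk B" if "B \<in> K" for B
    using that
  proof (induction "rk B" arbitrary: B rule: less_induct)
    case less
    show ?case
    proof (cases "B = T")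
      case False
      with up[OF less.prems] less.hyps[of "par B"] rk_par[of B] less.prems K show ?thesis by fastforce
    qed simp
  qed
  have disj: "B \<inter> ?N = {}" if "B \<in> \<pi> - K" for B
    using that block_disjoint K by blast
  have ne: "B \<noteq> ?N" if "B \<in> \<pi> - K" for B
    using disj[OF that] block_nonempty[of B] that by auto
  have N_S: "?N \<inter> S = T \<inter> S"
    using up K by blast
  have par_T: "par T \<in> \<pi> - K" if "T \<inter> S = {}"
    using par_in[OF T that] rk_par[OF T that] rk_T[of "par T"] by auto
  have card_N: "card ?N \<noteq> 1"
  proof
    assume "card ?N = 1"
    then obtain x where "?N = {x}" using card_1_singletonE by blast
    moreover obtain B where "B \<in> K" "B \<noteq> T" using K by blast
    moreover obtain b t where "b \<in> B" "t \<in> T"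
      using block_nonempty[of B] block_nonempty[OF T] \<open>B \<in> K\<close> K(1) by blast
    ultimately have "x \<in> B" "x \<in> T" using K(2) by auto
    with block_disjoint[of B T x] T K(1) \<open>B \<in> K\<close> \<open>B \<noteq> T\<close> show False by blast
  qed
  have part': "partition_on I (insert ?N (\<pi> - K))"
  proof -
    have "\<Union>(insert ?N (\<pi> - K)) = I" using part K by (auto simp: partition_on_def)
    moreover have "disjoint (insert ?N (\<pi> - K))"
      using part disj unfolding partition_on_def by (auto simp: pairwise_insert disjnt_def pairwise_def disjoint_def)
    moreover have "{} \<notin> insert ?N (\<pi> - K)" using part K T by (auto simp: partition_on_def)
    ultimately show ?thesis unfolding partition_on_def by blast
  qed
  show ?thesis
  proof (unfold_locales, goal_cases)
    case 5
    then show ?case using terminal_unique[OF T] N_S terminal_unique by auto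
  next
    case (6 B)
    then show ?case using pe_edges[of B] pe_edges[OF T] N_S by auto
  next
    case (7 B)
    then show ?case using pe_ends[of B] pe_ends[OF T] N_S ne[of B] by auto
  next
    case (8 B)
    then show ?case using lo_in[of B] lo_in[OF T] N_S ne[of B] K by auto
  next
    case (9 B)
    then show ?case using hi_in[of B] hi_in[OF T] N_S ne[of B] by auto
  next
    case (10 B)
    then show ?case using par_in[of B] par_T N_S ne[of B] by auto
  next
    case (11 B)
    then consider "B = ?N" "T \<inter> S = {}" | "B \<in> \<pi> - K" "B \<inter> S = {}"
      using N_S by auto
    then show ?case
    proof cases
      case 1
      then show ?thesis using par_T ne rk_par[OF T] by auto
    next
      case 2
      then show ?thesis using ne[of B] ne[of "par B"] rk_par[of B] rk_T[of "par B"] par_in[of B] by auto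
    qed
  next
    case (12 B)
    then show ?case using rk_root[of B] rk_root[OF T] N_S ne[of B] by auto
  next
    case (13 B)
    then consider "B = ?N" "T \<inter> S = {}" | "B \<in> \<pi> - K" "B \<inter> S = {}"
      using N_S by auto
    then show ?case
    proof cases
      case 1
      with 13 child_color[OF T] par_T ne[of "par T"] show ?thesis by auto
    next
      case 2
      with 13 card_N child_color[of B] ne[of B] ne[of "par B"] par_in[of B] show ?thesis
        by (auto split: if_splits)
    qed
  next
    case (14 B s v d)
    show ?case
    proof (cases "B = ?N")
      case True
      with 14 have "s \<in> T" "s \<in> S" using N_S by auto
      moreover from this have "exits T = []" by (auto simp: exits_def)
      ultimately show ?thesis using base_root[OF T, of s] conn[of v d] 14 True by simp
    next
      case False
      with 14 root_conn show ?thesis by blast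
    qed
  next
    case (15 B v d)
    show ?case
    proof (cases "B = ?N")
      case True
      with conn[of v d] 15 N_S show ?thesis by (simp add: exits_def base_def)
    next
      case False
      with 15 outer_conn show ?thesis by auto
    qed
  qed (use mg S_sub I_sub part' in auto)
qed

section \<open>Connections in merged blocks and between terminals\<close>

lemma tree_edge_conn:
  assumes B: "B \<in> \<pi>" "B \<inter> S = {}" "\<not> inner B" "\<not> inner (par B)" and v: "v \<in> B \<union> par B"
  shows "alt_conn G col (B \<union> par B) v (base (par B)) [d] (exits (par B))"
proof (cases "v \<in> B")
  case True
  have "alt_conn G col B v (lo B) [d] [col (pe B)]"
    using outer_conn B True by (simp add: inner_def)
  moreover have "alt_conn G col (par B) (hi B) (base (par B)) [col (pe B)] (exits (par B))"
    using conn_noninner par_in hi_in B by blast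
  ultimately show ?thesis
    using alt_conn_comp[OF mg par_disjoint pe_edges pe_ends] B(1,2) by blast
next
  case False
  then have "alt_conn G col (par B) v (base (par B)) [d] (exits (par B))"
    using conn_noninner par_in B v by blast
  then show ?thesis by (rule alt_conn_mono) blast
qed

text \<open>The trail runs once round the cycle. Its edges at \<open>t\<close> are predecessor edges
  of children of \<open>T\<close>, or possibly \<open>e\<close>; they avoid the color of
  \<open>pe T\<close> by the color condition on children and by freeness, respectively.\<close>

lemma inner_top_conn:
  assumes M: "chain X M T" and N: "chain Y N T" and MN: "M \<inter> N = {T}" and Y: "Y \<noteq> T"
    and xy: "x \<in> X" "y \<in> Y" and e: "e \<in> edges G" "ends G e = {x, y}"
    and free: "free x (col e)" "free y (col e)"
    and e_new: "\<And>B. B \<in> \<pi> \<Longrightarrow> B \<inter> S = {} \<Longrightarrow> e \<noteq> pe B"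
    and T: "inner T" "T = {t}"
  shows "alt_conn G col (\<Union>M \<union> \<Union>N) t t [col (pe T)] [col (pe T)]"
proof -
  have blocks: "M \<subseteq> \<pi>" "N \<subseteq> \<pi>" "T \<in> \<pi>"
    using chain_blocks M N chain_top by blast+
  have t: "t \<in> verts G" "t \<in> \<Union>M" using block_verts[OF blocks(3)] T(2) chain_top[OF M] by auto
  have child: "ends G (pe Z) = {lo Z, t} \<and> distinct_adj (col (pe Z) # [col (pe T)]) \<and>
      distinct_adj ([col (pe T)] @ [col (pe Z)])"
    if "Z \<in> \<pi>" "Z \<inter> S = {}" "par Z = T" for Z
    using pe_ends[OF that(1,2)] hi_in[OF that(1,2)] child_color[OF that(1,2)] that(3) T
    by (auto simp: inner_def)
  obtain Z2 N' where N': "N' \<subseteq> N - {T}" "chain Y N' Z2" "Z2 \<inter> S = {}" "par Z2 = T"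
    using chain_below_top[OF N Y] by blast
  have Z2: "Z2 \<in> \<pi>" "Z2 \<in> N'" using N' blocks chain_top by blast+
  have t_N': "t \<notin> \<Union>N'" using block_disjoint[OF _ blocks(3), of _ t] N'(1) blocks(2) T(2) by blast
  have conn_N': "alt_conn G col (\<Union>N') y (lo Z2) [col e] [col (pe Z2)]"
    using chain_conn[OF N'(2) xy(2) free(2)] N'(3) by (simp add: base_def exits_def)
  show ?thesis
  proof (cases "X = T")
    \<comment> \<open>Here \<open>e\<close> itself is one of the two edges at \<open>t\<close>, and
      \<open>e_new\<close> makes it different from the other one, \<open>pe Z2\<close>, to which it
      may be parallel.\<close>
    case True
    then have "x = t" using xy T by auto
    moreover have "col e \<noteq> col (pe T)"
      using free(1) True xy(1) T(1) blocks(3) by (auto simp: free_def)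
    ultimately have "alt_conn G col (insert t (\<Union>N')) t t [col (pe T)] [col (pe T)]"
      using e child[OF Z2(1) N'(3,4)] t
      by (intro alt_conn_close[OF e(1) _ pe_edges[OF Z2(1) N'(3)] _ e_new[OF Z2(1) N'(3)] t_N' conn_N'])
        auto
    then show ?thesis by (rule alt_conn_mono) (use N'(1) t in blast)
  next
    case False
    obtain Z1 M' where M': "M' \<subseteq> M - {T}" "chain X M' Z1" "Z1 \<inter> S = {}" "par Z1 = T"
      using chain_below_top[OF M False] by blast
    have Z1: "Z1 \<in> \<pi>" "Z1 \<in> M'" using M' blocks chain_top by blast+
    have disj: "M' \<inter> N' = {}" using M'(1) N'(1) MN by blast
    then have disj': "\<Union>M' \<inter> \<Union>N' = {}"
      by (intro Union_disjoint) (use M'(1) N'(1) blocks(1,2) in auto)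
    have t_M': "t \<notin> \<Union>M'" using block_disjoint[OF _ blocks(3), of _ t] M'(1) blocks(1) T(2) by blast
    have "alt_conn G col (\<Union>M') x (lo Z1) [col e] [col (pe Z1)]"
      using chain_conn[OF M'(2) xy(1) free(1)] M'(3) by (simp add: base_def exits_def)
    then have "alt_conn G col (\<Union>M') (lo Z1) x [col (pe Z1)] [col e]"
      using alt_conn_rev by fastforce
    from alt_conn_comp[OF mg disj' e this conn_N']
    have conn': "alt_conn G col (\<Union>M' \<union> \<Union>N') (lo Z1) (lo Z2) [col (pe Z1)] [col (pe Z2)]" .
    have ne: "pe Z1 \<noteq> pe Z2" using pe_inj[OF Z1(1) M'(3) Z2(1) N'(3)] Z1 Z2 disj by blast
    have "alt_conn G col (insert t (\<Union>M' \<union> \<Union>N')) t t [col (pe T)] [col (pe T)]"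
      using child[OF Z2(1) N'(3,4)] child[OF Z1(1) M'(3,4)] t t_M' t_N'
      by (intro alt_conn_close[OF pe_edges[OF Z1(1) M'(3)] _ pe_edges[OF Z2(1) N'(3)] _ ne _ conn'])
        (auto simp: insert_commute)
    then show ?thesis by (rule alt_conn_mono) (use N'(1) M'(1) t in blast)
  qed
qed

text \<open>If \<open>v\<close> is free for \<open>d\<close>, the chain from its block upwards
  suffices. Otherwise \<open>v\<close> is inner and \<open>d\<close> is the color of its predecessor
  edge, so the trail descends to \<open>x\<close>, crosses \<open>e\<close> and climbs the other
  chain.\<close>

lemma cycle_conn:
  assumes M: "chain X M T" and N: "chain Y N T" and MN: "M \<inter> N = {T}" and XY: "X \<noteq> Y"
    and xy: "x \<in> X" "y \<in> Y" and e: "e \<in> edges G" "ends G e = {x, y}"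
    and free: "free x (col e)" "free y (col e)"
    and e_new: "\<And>B. B \<in> \<pi> \<Longrightarrow> B \<inter> S = {} \<Longrightarrow> e \<noteq> pe B"
    and v: "v \<in> \<Union>M"
  shows "alt_conn G col (\<Union>M \<union> \<Union>N) v (base T) [d] (exits T)"
proof -
  have blocks: "M \<subseteq> \<pi>" "N \<subseteq> \<pi>" "T \<in> \<pi>"
    using chain_blocks M N chain_top by blast+
  obtain B where B: "B \<in> M" "v \<in> B" using v by blast
  show ?thesis
  proof (cases "free v d")
    case True
    obtain M' where "M' \<subseteq> M" "chain B M' T" using chain_suffix[OF M B(1)] by blast
    then show ?thesis
      using chain_conn[of B M' T v d] B(2) True by (auto elim!: alt_conn_mono)
  next
    case False
    then have inner: "inner B" and d: "d = col (pe B)"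
      using B blocks block_disjoint unfolding free_def by blast+
    have "B = {lo B}" using inner_eq inner B(1) blocks(1) by blast
    moreover from this have "v = lo B" using B(2) by blast
    ultimately have v_B: "B = {v}" "base B = v" "exits B = [d]"
      using inner d by (simp_all add: base_def exits_def inner_def)
    show ?thesis
    proof (cases "B = T")
      case True
      with v_B have T: "T = {v}" "inner T" "base T = v" "exits T = [col (pe T)]" "d = col (pe T)"
        using inner d by auto
      show ?thesis
      \<comment> \<open>\<open>inner_top_conn\<close> wants the second start to differ from
        \<open>T\<close>. Since \<open>X \<noteq> Y\<close>, exchanging the two sides settles the
        case \<open>Y = T\<close>.\<close>
      proof (cases "Y = T")
        case False
        from inner_top_conn[OF M N MN False xy e free e_new T(2,1)] T show ?thesis by simp
      next
        case True
        then have X: "X \<noteq> T" using XY by simp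
        have NM: "N \<inter> M = {T}" and e': "ends G e = {y, x}" using MN e(2) by auto
        from inner_top_conn[OF N M NM X xy(2,1) e(1) e' free(2,1) e_new T(2,1)]
        have "alt_conn G col (\<Union>M \<union> \<Union>N) v v [col (pe T)] [col (pe T)]"
          by (simp only: Un_commute)
        with T(3-5) show ?thesis by simp
      qed
    next
      case False
      obtain M' where M': "M' \<subseteq> M - {T}" "chain X M' B"
        using chain_prefix[OF M B(1) False] by blast
      \<comment> \<open>The climb from \<open>x\<close> to \<open>v\<close> is bordered at
        \<open>v\<close> by the color of the predecessor edge, which is \<open>d\<close>; reversed,
        it is a descent whose first color avoids \<open>d\<close>.\<close>
      have "alt_conn G col (\<Union>M') x v [col e] [d]"
        using chain_conn[OF M'(2) xy(1) free(1)] v_B by simp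
      then have "alt_conn G col (\<Union>M') v x [d] [col e]"
        using alt_conn_rev by fastforce
      \<comment> \<open>The part of the chain below \<open>B\<close> misses \<open>T\<close>, the
        only block common to both chains.\<close>
      moreover have "M' \<inter> N = {}" using M'(1) MN by blast
      then have "\<Union>M' \<inter> \<Union>N = {}"
        by (intro Union_disjoint) (use M'(1) blocks(1,2) in auto)
      ultimately have "alt_conn G col (\<Union>M' \<union> \<Union>N) v (base T) [d] (exits T)"
        using alt_conn_comp[OF mg _ e] chain_conn[OF N xy(2) free(2)] by blast
      then show ?thesis by (rule alt_conn_mono) (use M'(1) in blast)
    qed
  qed
qed

text \<open>One climb is reversed and joined to the other by \<open>e\<close>. The chains are
  disjoint, so the terminals reached are different.\<close>

lemma augmenting_conn:
  assumes M: "chain X M R" and N: "chain Y N R'" and MN: "M \<inter> N = {}"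
    and R: "R \<inter> S \<noteq> {}" "R' \<inter> S \<noteq> {}"
    and xy: "x \<in> X" "y \<in> Y" and e: "e \<in> edges G" "ends G e = {x, y}"
    and free: "free x (col e)" "free y (col e)"
  shows "\<exists>s\<in>S. \<exists>t\<in>S. s \<noteq> t \<and> alt_conn G col (verts G) s t [] []"
proof -
  have blocks: "M \<subseteq> \<pi>" "N \<subseteq> \<pi>" "R \<in> M" "R' \<in> N"
    using chain_blocks M N chain_top by blast+
  have disj: "\<Union>M \<inter> \<Union>N = {}"
    using Union_disjoint blocks(1,2) MN by blast
  have base: "base R \<in> R \<inter> S" "base R' \<in> R' \<inter> S"
    using base_root blocks R by blast+
  have "alt_conn G col (\<Union>M) x (base R) [col e] []"
    using chain_conn[OF M xy(1) free(1)] R by (simp add: exits_def)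
  then have "alt_conn G col (\<Union>M) (base R) x [] [col e]"
    using alt_conn_rev by fastforce
  moreover have "alt_conn G col (\<Union>N) y (base R') [col e] []"
    using chain_conn[OF N xy(2) free(2)] R by (simp add: exits_def)
  ultimately have "alt_conn G col (\<Union>M \<union> \<Union>N) (base R) (base R') [] []"
    using alt_conn_comp[OF mg disj e] by blast
  then have "alt_conn G col (verts G) (base R) (base R') [] []"
    by (rule alt_conn_mono) (use block_verts blocks in blast)
  moreover have "base R \<in> \<Union>M" "base R' \<in> \<Union>N"
    using base blocks(3,4) by auto
  then have "base R \<noteq> base R'"
    using disj by (metis disjoint_iff)
  ultimately show ?thesis using base by blast
qed

end

section \<open>Translation from and to colored blossom forests\<close>

lemma block_eq:
  assumes "partition_on I \<pi>" "B \<in> \<pi>" "v \<in> B"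
  shows "block \<pi> v = B"
  unfolding block_def
  by (rule the_equality) (use assms in \<open>auto simp: partition_on_def disjoint_def\<close>)

lemma block_in:
  assumes "partition_on I \<pi>" "v \<in> I"
  shows "block \<pi> v \<in> \<pi>" "v \<in> block \<pi> v"
proof -
  obtain B where "B \<in> \<pi>" "v \<in> B" using assms by (auto simp: partition_on_def)
  with block_eq[OF assms(1) this] show "block \<pi> v \<in> \<pi>" "v \<in> block \<pi> v" by simp_all
qed

context blossom_forest
begin

text \<open>The endpoint map is copied from the contraction, so that being a subgraph of it is only
  a question of which edges occur.\<close>

definition forest :: "('v set, 'e) rooted_graph" where
  "forest = \<lparr>verts = \<pi>, edges = pe ` {B \<in> \<pi>. B \<inter> S = {}}, ends = (\<lambda>e. {B \<in> \<pi>. ends G e \<inter> B \<noteq> {}}),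
     roots = {B \<in> \<pi>. B \<inter> S \<noteq> {}}\<rparr>"

lemma forest_simps [simp]:
  "verts forest = \<pi>" "edges forest = pe ` {B \<in> \<pi>. B \<inter> S = {}}"
  "ends forest e = {B \<in> \<pi>. ends G e \<inter> B \<noteq> {}}" "roots forest = {B \<in> \<pi>. B \<inter> S \<noteq> {}}"
  by (simp_all add: forest_def)

lemma finite_blocks: "finite \<pi>"
proof -
  have "finite I" using mg I_sub finite_subset unfolding multigraph_def by blast
  then show ?thesis using finite_elements part by blast
qed

lemma blocks_meeting_pe:
  assumes "B \<in> \<pi>" "B \<inter> S = {}"
  shows "{X \<in> \<pi>. ends G (pe B) \<inter> X \<noteq> {}} = {B, par B}"
proof -
  have "lo B \<in> X \<longleftrightarrow> X = B" "hi B \<in> X \<longleftrightarrow> X = par B" if "X \<in> \<pi>" for X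
    using block_disjoint[OF that assms(1) _ lo_in[OF assms]] lo_in[OF assms]
      block_disjoint[OF that par_in[OF assms] _ hi_in[OF assms]] hi_in[OF assms] by blast+
  then show ?thesis
    using pe_ends[OF assms] par_in[OF assms] assms(1) by auto
qed

sublocale forest: parent_forest forest pe par rk
proof (unfold_locales, goal_cases)
  case 1
  show ?case using finite_blocks by simp
next
  case 3
  show ?case by (auto intro!: arg_cong[of _ _ "image pe"])
next
  case (4 B)
  then show ?case using blocks_meeting_pe[of B] by simp
qed (use par_in rk_par in auto)

lemma roots_forest: "roots forest = block \<pi> ` S"
proof -
  have "B \<in> block \<pi> ` S" if "B \<in> \<pi>" "s \<in> B" "s \<in> S" for B s
    using block_eq[OF part that(1,2)] that(3) by blast
  moreover have "block \<pi> s \<in> \<pi>" "block \<pi> s \<inter> S \<noteq> {}" if "s \<in> S" for s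
    using block_in[OF part, of s] that S_sub by auto
  ultimately show ?thesis by auto
qed

lemma card_roots_forest: "card (roots forest) = card S"
proof -
  have "inj_on (block \<pi>) S"
  proof (rule inj_onI)
    fix s t assume "s \<in> S" "t \<in> S" "block \<pi> s = block \<pi> t"
    with block_in[OF part, of s] block_in[OF part, of t] S_sub terminal_unique[of "block \<pi> s" s t]
    show "s = t" by auto
  qed
  then show ?thesis by (simp add: roots_forest card_image del: forest_simps)
qed

lemma forest_subgraph: "is_subgraph forest (contract (induced G I) \<pi>)"
proof -
  have "pe B \<in> edges (contract (induced G I) \<pi>)" if B: "B \<in> \<pi>" "B \<inter> S = {}" for B
  proof -
    have "B \<noteq> par B" using rk_par[OF B] by auto
    moreover have "ends G (pe B) \<subseteq> I"
      using pe_ends[OF B] lo_in[OF B] hi_in[OF B] block_subset[OF B(1)] block_subset[OF par_in[OF B]]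
      by auto
    moreover have "ends G (pe B) \<inter> B \<noteq> {}" "ends G (pe B) \<inter> par B \<noteq> {}"
      using pe_ends[OF B] lo_in[OF B] hi_in[OF B] by auto
    ultimately show ?thesis
      using pe_edges[OF B] B(1) par_in[OF B] unfolding contract_def by auto
  qed
  then show ?thesis by (auto simp: is_subgraph_def contract_def)
qed

lemma colored_blossom_forest: "colored_blossom_forest G col S (I, \<pi>, forest)"
proof -
  have pred: "pred_edge forest B = pe B" if "B \<in> \<pi>" "B \<inter> S = {}" for B
    using forest.pred_edge_eq[of B] that by simp
  have root_blossom: "blossom (induced G (block \<pi> s)) col s" if "s \<in> S" for s
    using blossom_iff[OF block_verts, of "block \<pi> s" col s] block_in[OF part, of s] S_sub that
      root_conn[of "block \<pi> s" s] by auto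
  have children: "col f \<noteq> col (pred_edge forest B)"
    if B: "B \<in> \<pi>" "B \<inter> S = {}" "card B = 1" and f: "f \<in> edges forest"
      and child: "is_child forest B y" and ends: "ends forest f = {B, y}" for B y f
  proof -
    have y: "y \<in> \<pi>" "y \<inter> S = {}" "B \<noteq> y" "ends forest (pred_edge forest y) = {B, y}"
      using child unfolding is_child_def by auto
    then have "{y, par y} = {B, y}"
      using pred[of y] blocks_meeting_pe[of y] by simp
    with y(3) have par_y: "par y = B" by (auto simp: doubleton_eq_iff)
    obtain Z where Z: "Z \<in> \<pi>" "Z \<inter> S = {}" "f = pe Z" using f by auto
    then have "{Z, par Z} = {B, y}"
      using ends blocks_meeting_pe[of Z] by simp
    \<comment> \<open>The color condition ranges over all forest edges between \<open>B\<close> and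
      its child \<open>y\<close>; the ranks leave only the predecessor edge of
      \<open>y\<close>.\<close>
    then consider "Z = y" | "Z = B" "par Z = y" by (auto simp: doubleton_eq_iff)
    then have "Z = y"
      by cases (use rk_par[OF Z(1,2)] rk_par[OF y(1,2)] par_y in simp_all)
    with Z child_color[OF y(1,2)] par_y B pred[OF B(1,2)] show ?thesis by simp
  qed
  have outer_blossom: "c_blossom (induced G B) col (col (pred_edge forest B)) u"
    if B: "B \<in> \<pi>" "B \<inter> S = {}" "card B \<ge> 2" and u: "u \<in> B \<inter> ends G (pred_edge forest B)" for B u
  proof -
    have "u = lo B"
      using u pred[OF B(1,2)] pe_ends[OF B(1,2)] hi_in[OF B(1,2)] par_disjoint[OF B(1,2)] by auto
    moreover have "\<forall>v\<in>B. \<forall>d. alt_conn G col B v (lo B) [d] [col (pe B)]"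
      using outer_conn[OF B(1,2)] B(3) by simp
    ultimately show ?thesis
      using pred[OF B(1,2)] lo_in[OF B(1,2)] c_blossom_iff[OF block_verts[OF B(1)], of col "col (pe B)" "lo B"]
      by simp
  qed
  show ?thesis
    unfolding colored_blossom_forest_def prod.case
  proof (intro conjI ballI allI impI)
    show "card (graph_components forest) = card S"
      using forest.card_components card_roots_forest by simp
    show "is_subgraph forest (contract (induced G I) \<pi>)" by (rule forest_subgraph)
    show "rooted_forest forest" by (rule forest.rooted_forest)
    show "roots forest = block \<pi> ` S" by (rule roots_forest)
  next
    fix v y f
    assume "v \<in> I" "block \<pi> v \<notin> roots forest \<and> card (block \<pi> v) = 1" "f \<in> edges forest"
      "is_child forest (block \<pi> v) y \<and> ends forest f = {block \<pi> v, y}"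
    with children[of "block \<pi> v" f y] block_in[OF part, of v]
    show "col f \<noteq> col (pred_edge forest (block \<pi> v))" by auto
  next
    fix v u
    assume "v \<in> I" "block \<pi> v \<notin> roots forest \<and> 2 \<le> card (block \<pi> v)"
      "u \<in> block \<pi> v \<inter> ends G (pred_edge forest (block \<pi> v))"
    with outer_blossom[of "block \<pi> v" u] block_in[OF part, of v]
    show "c_blossom (induced G (block \<pi> v)) col (col (pred_edge forest (block \<pi> v))) u" by auto
  qed (use S_sub I_sub part root_blossom in auto)
qed

end

text \<open>The predecessor edges are those of \<open>F\<close> itself, so the colors of inner
  vertices need no translation later.\<close>

lemma colored_blossom_forest_imp:
  assumes mg: "multigraph G" and cbf: "colored_blossom_forest G col S (I, \<pi>, F)"
  shows "\<exists>par lo hi rk. blossom_forest G col S I \<pi> (pred_edge F) par lo hi rk \<and>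
    (\<forall>B\<in>\<pi>. B \<in> roots F \<longleftrightarrow> B \<inter> S \<noteq> {})"
proof -
  note D = cbf[unfolded colored_blossom_forest_def prod.case]
  have c: "S \<subseteq> I" "I \<subseteq> verts G" "partition_on I \<pi>" "rooted_forest F"
    "is_subgraph F (contract (induced G I) \<pi>)" "verts F = \<pi>"
    "card (graph_components F) = card S" "roots F = block \<pi> ` S"
    and root_blossom: "\<forall>s\<in>S. blossom (induced G (block \<pi> s)) col s"
    and inner_child: "\<forall>v\<in>I. block \<pi> v \<notin> roots F \<and> card (block \<pi> v) = 1 \<longrightarrow>
        (\<forall>y. \<forall>f\<in>edges F. is_child F (block \<pi> v) y \<and> ends F f = {block \<pi> v, y} \<longrightarrow>
           col f \<noteq> col (pred_edge F (block \<pi> v)))"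
    and outer_blossom: "\<forall>v\<in>I. block \<pi> v \<notin> roots F \<and> card (block \<pi> v) \<ge> 2 \<longrightarrow>
        (\<forall>u \<in> block \<pi> v \<inter> ends G (pred_edge F (block \<pi> v)).
           c_blossom (induced G (block \<pi> v)) col (col (pred_edge F (block \<pi> v))) u)"
    using D by - (elim conjE, assumption)+
  note part = c(3)
  have fin: "finite (verts G)" using mg by (simp add: multigraph_def)
  then have finS: "finite S" using finite_subset[OF subset_trans[OF c(1,2)]] by simp
  obtain par rk where pf: "parent_forest F (pred_edge F) par rk" and rk0: "\<And>r. r \<in> roots F \<Longrightarrow> rk r = 0"
    using rooted_forest_imp_parent_forest[OF c(4)] by blast
  interpret pf: parent_forest F "pred_edge F" par rk by (rule pf)
  have root_iff: "B \<in> roots F \<longleftrightarrow> B \<inter> S \<noteq> {}" if "B \<in> \<pi>" for B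
  proof
    assume "B \<in> roots F"
    then obtain s where "s \<in> S" "B = block \<pi> s" using c(8) by auto
    with block_in(2)[OF part, of s] c(1) show "B \<inter> S \<noteq> {}" by auto
  next
    assume "B \<inter> S \<noteq> {}"
    then obtain s where "s \<in> S" "s \<in> B" by blast
    with block_eq[OF part that] c(8) show "B \<in> roots F" by auto
  qed
  have nonroot: "B \<in> verts F - roots F" if "B \<in> \<pi>" "B \<inter> S = {}" for B
    using that root_iff c(6) by auto
  \<comment> \<open>There are as many roots as components and as many components as terminals, so
    different terminals lie in different blocks.\<close>
  have "card (block \<pi> ` S) = card S"
    using pf.card_components c(7,8) by simp
  then have inj: "inj_on (block \<pi>) S"
    using finS by (simp add: eq_card_imp_inj_on)
  have F_edge: "e \<in> edges G \<and> ends G e \<subseteq> I \<and> ends F e = {B \<in> \<pi>. ends G e \<inter> B \<noteq> {}}"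
    if "e \<in> edges F" for e
    using c(5) that by (auto simp: is_subgraph_def contract_def)
  have pe: "pred_edge F B \<in> edges F" "ends F (pred_edge F B) = {B, par B}" "par B \<in> \<pi>" "rk (par B) < rk B"
    if "B \<in> \<pi>" "B \<inter> S = {}" for B
    using nonroot[OF that] pf.ends_pe pf.par_verts pf.rk_par c(6) by (auto simp: pf.edges_eq)
  \<comment> \<open>As an edge of the contraction, the predecessor edge meets exactly the blocks
    \<open>B\<close> and \<open>par B\<close>, so each contains one of its two ends.\<close>
  have "\<exists>l h. ends G (pred_edge F B) = {l, h} \<and> l \<in> B \<and> h \<in> par B" if B: "B \<in> \<pi>" "B \<inter> S = {}" for B
  proof -
    let ?e = "pred_edge F B"
    have e: "?e \<in> edges G" "{X \<in> \<pi>. ends G ?e \<inter> X \<noteq> {}} = {B, par B}"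
      using F_edge[OF pe(1)[OF B]] pe(2)[OF B] by auto
    then have "B \<in> {X \<in> \<pi>. ends G ?e \<inter> X \<noteq> {}}" "par B \<in> {X \<in> \<pi>. ends G ?e \<inter> X \<noteq> {}}"
      by auto
    then obtain l h where lh: "l \<in> ends G ?e" "l \<in> B" "h \<in> ends G ?e" "h \<in> par B" by auto
    have "l \<noteq> h"
    proof
      assume "l = h"
      then have "B = par B"
        using block_eq[OF part B(1) lh(2)] block_eq[OF part pe(3)[OF B] lh(4)] by simp
      with pe(4)[OF B] show False by simp
    qed
    moreover obtain a b where "ends G ?e = {a, b}"
      using mg e(1) by (auto simp: multigraph_def card_2_iff)
    ultimately have "ends G ?e = {l, h}" using lh by auto
    with lh show ?thesis by blast
  qed
  then obtain lo hi where lohi: "\<And>B. B \<in> \<pi> \<Longrightarrow> B \<inter> S = {} \<Longrightarrow>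
      ends G (pred_edge F B) = {lo B, hi B} \<and> lo B \<in> B \<and> hi B \<in> par B"
    by metis
  have sub: "B \<subseteq> I" "B \<subseteq> verts G" "B \<noteq> {}" if "B \<in> \<pi>" for B
    using that part c(2) by (auto simp: partition_on_def)
  have "blossom_forest G col S I \<pi> (pred_edge F) par lo hi rk"
  proof (unfold_locales, goal_cases)
    case (5 B s t)
    then have "block \<pi> s = block \<pi> t" using block_eq[OF part, of B] by simp
    with inj 5 show ?case by (auto dest: inj_onD)
  next
    case (6 B)
    then show ?case using F_edge pe(1) by blast
  next
    case (12 B)
    then show ?case using rk0 root_iff by blast
  next
    case (13 B)
    then have P: "par B \<in> \<pi>" "par B \<notin> roots F" using pe(3) root_iff by auto
    then obtain v where v: "v \<in> par B" "v \<in> I" using sub(1,3)[OF P(1)] by blast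
    have "block \<pi> v = par B" using block_eq[OF part P(1) v(1)] .
    moreover have "is_child F (par B) B"
      using 13 nonroot[of B] pe(2)[of B] pe(4)[of B] unfolding is_child_def by auto
    ultimately show ?case
      using inner_child[rule_format, OF v(2), of "pred_edge F B" B] 13 P pe(1,2)[of B]
      by (simp add: insert_commute)
  next
    case (14 B s v d)
    then have "block \<pi> s = B" using block_eq[OF part, of B] by simp
    with bspec[OF root_blossom, of s] 14 blossom_iff[of B G col s] sub(2)[of B] show ?case by auto
  next
    case (15 B v d)
    then have "block \<pi> v = B" "v \<in> I" "B \<notin> roots F"
      using block_eq[OF part, of B v] sub(1)[of B] root_iff by auto
    moreover have "finite B" using finite_subset[OF sub(2)[OF 15(1)] fin] .
    then have "card B \<ge> 2" using 15(3) sub(3)[OF 15(1)] by (cases "card B") auto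
    moreover have "lo B \<in> B \<inter> ends G (pred_edge F B)" using lohi 15 by blast
    ultimately have "c_blossom (induced G B) col (col (pred_edge F B)) (lo B)"
      using outer_blossom[rule_format, of v "lo B"] by simp
    with c_blossom_iff[of B G col] sub(2) 15 show ?case by blast
  qed (use mg c lohi pe in auto)
  then show ?thesis using root_iff by blast
qed

section \<open>Maximal blossom forests\<close>

context blossom_forest
begin

text \<open>The order compares only \<open>I\<close> and \<open>\<pi>\<close>, so \<open>F\<close>
  is arbitrary here: any forest on a larger vertex set refutes maximality.\<close>

lemma maximal_edge_leaving:
  assumes max: "\<not> (\<exists>T'. colored_blossom_forest G col S T' \<and> forest_less (I, \<pi>, F) T')"
    and v: "v \<in> I" and w: "w \<notin> I" and e: "e \<in> edges G" "ends G e = {v, w}"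
  shows "\<not> free v (col e)"
proof
  assume free: "free v (col e)"
  obtain B where B: "B \<in> \<pi>" "v \<in> B" using block_exists v by blast
  have "w \<in> verts G" using e mg by (auto simp: multigraph_def)
  from grow[OF B this w e free] interpret new: blossom_forest G col S "insert w I" "insert {w} \<pi>"
    "pe({w} := e)" "par({w} := B)" "lo({w} := w)" "hi({w} := v)" "rk({w} := Suc (rk B))" .
  have "forest_less (I, \<pi>, F) (insert w I, insert {w} \<pi>, new.forest)"
    using w by (auto simp: forest_less_def)
  with max new.colored_blossom_forest show False by blast
qed

lemma maximal_no_contraction:
  assumes max: "\<not> (\<exists>T'. colored_blossom_forest G col S T' \<and> forest_less (I, \<pi>, F) T')"
    and K: "K \<subseteq> \<pi>" "T \<in> K" "X \<in> K" "X \<noteq> T"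
    and up: "\<And>B. B \<in> K \<Longrightarrow> B \<noteq> T \<Longrightarrow> B \<inter> S = {} \<and> par B \<in> K"
    and conn: "\<And>v d. v \<in> \<Union>K \<Longrightarrow> alt_conn G col (\<Union>K) v (base T) [d] (exits T)"
  shows False
proof -
  let ?\<pi>' = "insert (\<Union>K) (\<pi> - K)"
  have "K \<noteq> {T}" using K by blast
  from contract_blocks[OF K(1,2) this up conn]
  interpret new: blossom_forest G col S I ?\<pi>' "pe(\<Union>K := pe T)"
    "\<lambda>B. if B = \<Union>K then par T else if par B \<in> K then \<Union>K else par B"
    "lo(\<Union>K := lo T)" "hi(\<Union>K := hi T)" "rk(\<Union>K := rk T)" .
  \<comment> \<open>\<open>X\<close> is nonempty and disjoint from \<open>T\<close>, so
    \<open>T\<close> is no longer a block and the new partition is strictly coarser.\<close>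
  have "T \<noteq> \<Union>K"
  proof
    assume "T = \<Union>K"
    then have "X \<subseteq> T" using K(3) by blast
    then show False
      using block_nonempty[of X] block_disjoint[of X T] K by blast
  qed
  then have "T \<notin> ?\<pi>'" using K(2) by blast
  then have "\<pi> \<noteq> ?\<pi>'" using K(1,2) by blast
  moreover have "\<forall>B\<in>\<pi>. \<exists>B'\<in>?\<pi>'. B \<subseteq> B'" by blast
  ultimately have "forest_less (I, \<pi>, F) (I, ?\<pi>', new.forest)"
    unfolding forest_less_def by simp
  with max new.colored_blossom_forest show False by blast
qed

lemma maximal_edge_between:
  assumes max: "\<not> (\<exists>T'. colored_blossom_forest G col S T' \<and> forest_less (I, \<pi>, F) T')"
    and no_aug: "\<not> (\<exists>s\<in>S. \<exists>t\<in>S. s \<noteq> t \<and> alt_conn G col (verts G) s t [] [])"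
    and X: "X \<in> \<pi>" "x \<in> X" and Y: "Y \<in> \<pi>" "y \<in> Y" and XY: "X \<noteq> Y"
    and e: "e \<in> edges G" "ends G e = {x, y}" and free: "free x (col e)" "free y (col e)"
  shows "\<exists>Z\<in>\<pi>. Z \<inter> S = {} \<and> e = pe Z \<and> \<not> inner Z \<and> inner (par Z)"
proof (cases "\<exists>Z\<in>\<pi>. Z \<inter> S = {} \<and> e = pe Z")
  case True
  then obtain Z where Z: "Z \<in> \<pi>" "Z \<inter> S = {}" "e = pe Z" by blast
  \<comment> \<open>An inner vertex is never free for the color of its own predecessor edge, so
    freeness at the lower end excludes that \<open>Z\<close> is inner.\<close>
  have "lo Z \<in> {x, y}" using pe_ends[OF Z(1,2)] Z(3) e(2) by auto
  then have "free (lo Z) (col (pe Z))" using free Z(3) by auto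
  then have "\<not> inner Z" using lo_in[OF Z(1,2)] Z(1) by (auto simp: free_def)
  moreover have "inner (par Z)"
  proof (rule ccontr)
    assume "\<not> inner (par Z)"
    with tree_edge_conn[OF Z(1,2) \<open>\<not> inner Z\<close>]
    have "alt_conn G col (\<Union>{Z, par Z}) v (base (par Z)) [d] (exits (par Z))" if "v \<in> \<Union>{Z, par Z}" for v d
      using that by simp
    moreover have "Z \<noteq> par Z" using rk_par[OF Z(1,2)] by auto
    ultimately show False
      using maximal_no_contraction[OF max, of "{Z, par Z}" "par Z" Z] Z par_in[OF Z(1,2)] by blast
  qed
  ultimately show ?thesis using Z by blast
next
  case False
  then have e_new: "\<And>B. B \<in> \<pi> \<Longrightarrow> B \<inter> S = {} \<Longrightarrow> e \<noteq> pe B" by blast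
  from chain_to_root_or_meet[OF X(1) Y(1)] have False
  proof (elim disjE exE conjE)
    fix M N T assume M: "chain X M T" and N: "chain Y N T" and MN: "M \<inter> N = {T}"
    have NM: "N \<inter> M = {T}" and e': "ends G e = {y, x}" using MN e(2) by auto
    have conn: "alt_conn G col (\<Union>(M \<union> N)) v (base T) [d] (exits T)" if "v \<in> \<Union>(M \<union> N)" for v d
    proof (cases "v \<in> \<Union>M")
      case True
      from cycle_conn[OF M N MN XY X(2) Y(2) e free e_new True] show ?thesis by simp
    next
      case False
      then have "v \<in> \<Union>N" using that by auto
      from cycle_conn[OF N M NM XY[symmetric] Y(2) X(2) e(1) e' free(2,1) e_new this]
      have "alt_conn G col (\<Union>N \<union> \<Union>M) v (base T) [d] (exits T)" .
      then show ?thesis by (simp add: Un_commute)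
    qed
    \<comment> \<open>The two chains start in different blocks, so one of them has a block other
      than \<open>T\<close>.\<close>
    obtain Z where Z: "Z \<in> M \<union> N" "Z \<noteq> T"
      using chain_bottom[OF M] chain_bottom[OF N] XY by blast
    have K: "M \<union> N \<subseteq> \<pi>" "T \<in> M \<union> N"
      using chain_blocks[OF M] chain_blocks[OF N] chain_top[OF M] by auto
    have up: "B \<inter> S = {} \<and> par B \<in> M \<union> N" if "B \<in> M \<union> N" "B \<noteq> T" for B
      using that chain_par[OF M, of B] chain_par[OF N, of B] by auto
    from maximal_no_contraction[OF max K Z up conn] show False .
  next
    fix M N R R' assume "chain X M R" "chain Y N R'" "M \<inter> N = {}" "R \<inter> S \<noteq> {}" "R' \<inter> S \<noteq> {}"
    from augmenting_conn[OF this X(2) Y(2) e free] no_aug show False by blast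
  qed
  then show ?thesis ..
qed

end

theorem theorem2p10:
  fixes G :: "('v, 'e) mgraph"
    and Cols :: "'c set"
    and col :: "'e \<Rightarrow> 'c"
    and S I A :: "'v set"
    and \<pi> :: "'v set set"
    and F :: "('v set, 'e) rooted_graph"
    and Ac :: "'c \<Rightarrow> 'v set"
  assumes "multigraph G"
    and "\<exists>c\<in>Cols. \<exists>d\<in>Cols. c \<noteq> d"
    and "\<forall>e\<in>edges G. col e \<in> Cols"
    and "S \<subseteq> verts G"
    and "\<not> (\<exists>u vs es v. alternating_trail G col u vs es v \<and> connects_distinct_terminals G S vs es)"
    and "maximal_cbf G col S (I, \<pi>, F)"
    and "A = inner_vertices (I, \<pi>, F)"
    and "\<And>c. c \<in> Cols \<Longrightarrow> Ac c = {u \<in> A. col (pred_edge F (block \<pi> u)) = c}"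
  shows "tutte_set G col Cols S A Ac"
proof -
  note mg = assms(1) and A_def = assms(7) and Ac = assms(8)
  have cbf: "colored_blossom_forest G col S (I, \<pi>, F)"
    and max: "\<not> (\<exists>T'. colored_blossom_forest G col S T' \<and> forest_less (I, \<pi>, F) T')"
    using assms(6) unfolding maximal_cbf_def by auto
  obtain par lo hi rk where bf: "blossom_forest G col S I \<pi> (pred_edge F) par lo hi rk"
    and root_iff: "\<forall>B\<in>\<pi>. B \<in> roots F \<longleftrightarrow> B \<inter> S \<noteq> {}"
    using colored_blossom_forest_imp[OF mg cbf] by (elim exE conjE) (rule that)
  interpret blossom_forest G col S I \<pi> "pred_edge F" par lo hi rk by (rule bf)
  \<comment> \<open>For distinct ends the closing condition is vacuous, so internal alternation is
    enough to contradict the hypothesis.\<close>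
  have no_aug: "\<not> (\<exists>s\<in>S. \<exists>t\<in>S. s \<noteq> t \<and> alt_conn G col (verts G) s t [] [])"
  proof
    assume "\<exists>s\<in>S. \<exists>t\<in>S. s \<noteq> t \<and> alt_conn G col (verts G) s t [] []"
    then obtain s t es where st: "s \<in> S" "t \<in> S" "s \<noteq> t" "edge_walk (induced G (verts G)) s es t"
      "distinct es" "distinct_adj (map col es)"
      unfolding alt_conn_def by auto
    then obtain vs where vs: "int_alternating_trail G col s vs es t"
      using ex_int_alternating_trail_iff[of G col s es t] edge_walk_of_induced[OF st(4)] by blast
    then have "alternating_trail G col s vs es t" "is_trail G s vs es t"
      using st(3) by (auto simp: alternating_trail_def int_alternating_trail_def)
    with st assms(5) show False unfolding connects_distinct_terminals_def by blast
  qed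
  have A_sub: "A \<subseteq> I" using A_def by (auto simp: inner_vertices_def)
  have A_iff: "v \<in> A \<longleftrightarrow> inner B" if "B \<in> \<pi>" "v \<in> B" for B v
    using A_def that block_eq[OF part that] block_subset[OF that(1)] bspec[OF root_iff that(1)]
    by (auto simp: inner_vertices_def inner_def)
  have inner_A: "\<exists>B\<in>\<pi>. v \<in> B \<and> inner B \<and> col (pred_edge F B) = col (pred_edge F (block \<pi> v))"
    if "v \<in> A" for v
    using block_in[OF part, of v] A_sub A_iff that by blast
  have free_A: "free u d" if "u \<in> A" "c \<in> Cols" "u \<in> Ac c" "d \<noteq> c" for u c d
    using Ac[OF that(2)] that(3,4) block_eq[OF part] unfolding free_def by auto
  have free_not_A: "free v d" if "v \<in> I" "v \<notin> A" for v d
    using block_exists[OF that(1)] free_noninner A_iff that(2) by blast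
  \<comment> \<open>A vertex of \<open>I\<close> outside \<open>A\<close> is free for every color,
    which maximality forbids at an edge leaving \<open>I\<close>.\<close>
  have leave: "v \<in> A" if "e \<in> edges G" "ends G e = {v, w}" "v \<in> I" "w \<notin> I" for e v w
    using maximal_edge_leaving[OF max that(3,4,1,2)] free_not_A that(3) by blast
  have mism: "\<exists>Z\<in>\<pi>. Z \<inter> S = {} \<and> e = pred_edge F Z \<and> \<not> inner Z \<and> inner (par Z)"
    if m: "mismatched G col Cols A Ac e" for e
  proof -
    have e: "e \<in> edges G" using m by (auto simp: mismatched_def)
    consider u v c where "u \<in> A" "v \<in> verts G - A" "ends G e = {u, v}" "c \<in> Cols" "u \<in> Ac c" "col e \<noteq> c"
      | u v c d where "u \<in> A" "v \<in> A" "ends G e = {u, v}" "c \<in> Cols" "d \<in> Cols" "u \<in> Ac c" "v \<in> Ac d"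
        "col e \<noteq> c" "col e \<noteq> d"
      using m unfolding mismatched_def by blast
    then show ?thesis
    proof cases
      case 1
      have free_u: "free u (col e)" using free_A 1 by blast
      have u: "u \<in> I" using 1 A_sub by blast
      \<comment> \<open>So far \<open>v\<close> is only known to lie outside \<open>A\<close>; as
        \<open>u\<close> is free, the edge cannot leave \<open>I\<close>.\<close>
      have v: "v \<in> I"
        using maximal_edge_leaving[OF max u _ e 1(3)] free_u by blast
      then have free_v: "free v (col e)" using free_not_A 1 by blast
      obtain X Y where XY: "X \<in> \<pi>" "u \<in> X" "Y \<in> \<pi>" "v \<in> Y" using block_exists u v by meson
      then have "X \<noteq> Y" using A_iff 1 by blast
      from maximal_edge_between[OF max no_aug XY this e 1(3) free_u free_v] show ?thesis .
    next
      case 2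
      have free: "free u (col e)" "free v (col e)" using free_A 2 by blast+
      obtain X Y where XY: "X \<in> \<pi>" "u \<in> X" "inner X" "Y \<in> \<pi>" "v \<in> Y" "inner Y"
        using inner_A[OF 2(1)] inner_A[OF 2(2)] by blast
      have "u \<noteq> v" using mg e 2(3) by (auto simp: multigraph_def)
      moreover have "X = {u}" "Y = {v}"
        using inner_eq[OF XY(1,3)] XY(2) inner_eq[OF XY(4,6)] XY(5) by (metis singletonD)+
      ultimately have "X \<noteq> Y" by simp
      from maximal_edge_between[OF max no_aug XY(1,2,4,5) this e 2(3) free] show ?thesis .
    qed
  qed
  \<comment> \<open>Edges leaving \<open>I\<close> have an end in \<open>A\<close>, and so do the
    exceptional edges of \<open>maximal_edge_between\<close>, namely \<open>hi Z\<close>. Hence no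
    edge of \<open>G - A\<close> leaves a block or enters \<open>I\<close>.\<close>
  have component: "H \<inter> I = {} \<or> (\<exists>B\<in>\<pi>. \<not> inner B \<and> H \<subseteq> B)"
    if H: "H \<in> graph_components (induced G (verts G - A))" for H
  proof -
    obtain x where x: "x \<in> verts G" "x \<notin> A" "H = component_of (induced G (verts G - A)) x"
      using H by (auto simp: graph_components_def)
    show ?thesis
    proof (cases "x \<in> I")
      case False
      have "H \<subseteq> - I" unfolding x(3)
      proof (rule component_of_subset)
        fix e a b assume e: "e \<in> edges (induced G (verts G - A))" "ends (induced G (verts G - A)) e = {a, b}"
          and a: "a \<in> - I"
        then have "b \<notin> A" "e \<in> edges G" "ends G e = {b, a}" by auto
        with leave[of e b a] a show "b \<in> - I" by auto
      qed (use False in simp)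
      then show ?thesis by blast
    next
      case True
      then obtain B where B: "B \<in> \<pi>" "x \<in> B" using block_exists by blast
      then have inner: "\<not> inner B" using A_iff x(2) by blast
      have "H \<subseteq> B" unfolding x(3)
      proof (rule component_of_subset)
        fix e a b assume "e \<in> edges (induced G (verts G - A))" "ends (induced G (verts G - A)) e = {a, b}"
          and a: "a \<in> B"
        then have e: "e \<in> edges G" "ends G e = {a, b}" "a \<notin> A" "b \<notin> A" by auto
        have "a \<in> I" using a block_subset[OF B(1)] by blast
        then have "b \<in> I" using leave[OF e(1,2)] e(3) by blast
        then obtain B' where B': "B' \<in> \<pi>" "b \<in> B'" using block_exists by blast
        show "b \<in> B"
        proof (rule ccontr)
          assume "b \<notin> B"
          then have "B \<noteq> B'" using B' by blast
          have "free a (col e)" "free b (col e)"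
            using free_not_A \<open>a \<in> I\<close> \<open>b \<in> I\<close> e(3,4) by blast+
          from maximal_edge_between[OF max no_aug B(1) a B' \<open>B \<noteq> B'\<close> e(1,2) this]
          obtain Z where Z: "Z \<in> \<pi>" "Z \<inter> S = {}" "e = pred_edge F Z" "inner (par Z)" by blast
          then have "hi Z \<in> A" using A_iff[OF par_in hi_in] by blast
          moreover have "hi Z \<in> {a, b}" using pe_ends[OF Z(1,2)] Z(3) e(2) by auto
          ultimately show False using e(3,4) by blast
        qed
      qed (rule B(2))
      with inner B(1) show ?thesis by blast
    qed
  qed
  \<comment> \<open>The upper end \<open>hi Z\<close> lies in an inner block, so the edge can meet
    \<open>B\<close> only in \<open>lo Z\<close>. A component inside \<open>B\<close> can therefore
    meet no mismatched edge but the predecessor edge of \<open>B\<close>.\<close>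
  have mism_block: "Z = B"
    if "Z \<in> \<pi>" "Z \<inter> S = {}" "inner (par Z)" "B \<in> \<pi>" "\<not> inner B" "ends G (pred_edge F Z) \<inter> B \<noteq> {}" for Z B
  proof -
    have "hi Z \<notin> B" using block_disjoint[OF par_in[OF that(1,2)] that(4) hi_in[OF that(1,2)]] that(3,5) by blast
    then have "lo Z \<in> B" using that(6) pe_ends[OF that(1,2)] by auto
    with block_disjoint[OF that(1,4) lo_in[OF that(1,2)]] show ?thesis by blast
  qed
  have ends_I: "ends G (pred_edge F Z) \<subseteq> I" if "Z \<in> \<pi>" "Z \<inter> S = {}" for Z
    using pe_ends[OF that] lo_in[OF that] hi_in[OF that] block_subset[OF that(1)]
      block_subset[OF par_in[OF that]] by auto
  show ?thesis
    unfolding tutte_set_def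
  proof (intro conjI ballI impI)
    have "v \<notin> S" if "v \<in> A" for v
      using inner_A[OF that] by (auto simp: inner_def)
    then show "A \<subseteq> verts G - S" using A_sub I_sub by blast
    have "col (pred_edge F (block \<pi> v)) \<in> Cols" if "v \<in> A" for v
      using inner_A[OF that] pe_edges assms(3) unfolding inner_def by metis
    then show "A = (\<Union>c\<in>Cols. Ac c)" using Ac by auto
    show "disjoint_family_on Ac Cols" using Ac by (auto simp: disjoint_family_on_def)
  next
    fix H assume "H \<in> graph_components (induced G (verts G - A))"
    from component[OF this] show "card (H \<inter> S) \<le> 1"
    proof
      assume "H \<inter> I = {}"
      then have "H \<inter> S = {}" using S_sub by blast
      then show ?thesis by simp
    next
      assume "\<exists>B\<in>\<pi>. \<not> inner B \<and> H \<subseteq> B"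
      then obtain B where "B \<in> \<pi>" "H \<subseteq> B" by blast
      then have "finite (H \<inter> S)" "\<forall>s\<in>H \<inter> S. \<forall>t\<in>H \<inter> S. s = t"
        using finite_block[of B] terminal_unique[of B] finite_subset[of H B] by auto
      then show ?thesis using card_le_Suc0_iff_eq by fastforce
    qed
  next
    fix H assume "H \<in> graph_components (induced G (verts G - A))" and HS: "H \<inter> S \<noteq> {}"
    from component[OF this(1)] HS S_sub obtain B where B: "B \<in> \<pi>" "\<not> inner B" "H \<subseteq> B" by blast
    show "\<not> (\<exists>e. mismatched G col Cols A Ac e \<and> ends G e \<inter> H \<noteq> {})"
    proof
      assume "\<exists>e. mismatched G col Cols A Ac e \<and> ends G e \<inter> H \<noteq> {}"
      then obtain e where e: "mismatched G col Cols A Ac e" "ends G e \<inter> H \<noteq> {}" by blast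
      from mism[OF e(1)] obtain Z where Z: "Z \<in> \<pi>" "Z \<inter> S = {}" "e = pred_edge F Z" "inner (par Z)"
        by blast
      have "ends G (pred_edge F Z) \<inter> B \<noteq> {}" using e(2) Z(3) B(3) by blast
      \<comment> \<open>The block met by the edge would be \<open>Z\<close>, which contains no
        terminal.\<close>
      from mism_block[OF Z(1,2,4) B(1,2) this] Z(2) HS B(3) show False by blast
    qed
  next
    fix H assume "H \<in> graph_components (induced G (verts G - A))"
    from component[OF this] have "\<exists>f. {e. mismatched G col Cols A Ac e \<and> ends G e \<inter> H \<noteq> {}} \<subseteq> {f}"
    proof
      assume H: "H \<inter> I = {}"
      have False if "mismatched G col Cols A Ac e" "ends G e \<inter> H \<noteq> {}" for e
        using mism[OF that(1)] ends_I that(2) H by blast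
      then show ?thesis by blast
    next
      assume "\<exists>B\<in>\<pi>. \<not> inner B \<and> H \<subseteq> B"
      then obtain B where B: "B \<in> \<pi>" "\<not> inner B" "H \<subseteq> B" by blast
      have "e = pred_edge F B" if e: "mismatched G col Cols A Ac e" "ends G e \<inter> H \<noteq> {}" for e
      proof -
        from mism[OF e(1)] obtain Z where Z: "Z \<in> \<pi>" "Z \<inter> S = {}" "e = pred_edge F Z" "inner (par Z)"
          by blast
        have "ends G (pred_edge F Z) \<inter> B \<noteq> {}" using e(2) Z(3) B(3) by blast
        from mism_block[OF Z(1,2,4) B(1,2) this] Z(3) show ?thesis by simp
      qed
      then show ?thesis by blast
    qed
    then obtain f where "{e. mismatched G col Cols A Ac e \<and> ends G e \<inter> H \<noteq> {}} \<subseteq> {f}" by blast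
    then show "card {e. mismatched G col Cols A Ac e \<and> ends G e \<inter> H \<noteq> {}} \<le> 1"
      using card_mono[of "{f}"] by fastforce
  next
    show "\<not> (\<exists>e. mismatched G col Cols A Ac e \<and> ends G e \<subseteq> A)"
    proof
      assume "\<exists>e. mismatched G col Cols A Ac e \<and> ends G e \<subseteq> A"
      then obtain e where e: "mismatched G col Cols A Ac e" "ends G e \<subseteq> A" by blast
      from mism[OF e(1)] obtain Z where Z: "Z \<in> \<pi>" "Z \<inter> S = {}" "e = pred_edge F Z" "\<not> inner Z"
        by blast
      \<comment> \<open>The lower end of a mismatched edge belongs to a block that is not inner,
        hence not to \<open>A\<close>.\<close>
      then have "lo Z \<in> A" using pe_ends[OF Z(1,2)] e(2) by auto
      with A_iff[OF Z(1) lo_in[OF Z(1,2)]] Z(4) show False by simp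
    qed
  qed
qed

end
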